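(* Let $G$ be a connected Lie group with Lie algebra $\mathfrak{g}$ endowed with a left-invariant (sub-)Lorentzian structure given by $(\mathfrak{p},\langle\cdot,\cdot\rangle,e_0)$ and an orthonormal basis $e_0,\dots,e_n$ of $\mathfrak{g}$ such that $e_0,\dots,e_r$ is a basis of $\mathfrak{p}$. Then any normal timelike extremal $g=g(t)$, $t\in\mathbb{R}$, of the corresponding left-invariant (sub-)Lorentzian (anti)metric on $G$, parametrized by arclength, is a solution (together with a covector function with components $\psi_j=\psi_j(t)$, $j=0,\dots,n$) of the system of differential equations $$g'(t)=dl_{g(t)}(u(t)),\quad u(t)=\psi_0(t)e_0-\sum_{i=1}^{r}\psi_i(t)e_i,\quad \|u(0)\|=1,\quad \psi_0(t)>0,$$ $$\psi_j'(t)=\sum_{k=0}^{n}\left(C_{0j}^{k}\psi_0\psi_k-\sum_{i=1}^{r}C_{ij}^{k}\psi_i\psi_k\right),\quad j=0,\dots,n,$$ where $C_{ij}^k$ are the structure constants of $\mathfrak{g}$ in the basis $e_0,\dots,e_n$, i.e. $[e_i,e_j]=\sum_{k=0}^n C_{ij}^k e_k$.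
   Context: Setting: $G$ is a connected Lie group with unit $e$ and Lie algebra $(\mathfrak{g},[\cdot,\cdot])$; $\mathfrak{p}\subset\mathfrak{g}$ is a subspace generating $\mathfrak{g}$ by the bracket; $\langle\cdot,\cdot\rangle$ is a pseudoscalar product of signature $(+,-,\dots,-)$ on $\mathfrak{g}$; $e_0,\dots,e_n$ is an orthonormal basis of $\mathfrak{g}$ ($\langle e_0,e_0\rangle=1$, $\langle e_i,e_i\rangle=-1$ for $i\ge 1$, $\langle e_i,e_j\rangle=0$ for $i\ne j$) such that $e_0,\dots,e_r$ is a basis of $\mathfrak{p}$; $e_0$ gives the time orientation. $l_g$ is the left shift $h\mapsto gh$, $dl_g$ its differential, and $\|u\|=\sqrt{\langle u,u\rangle}$ when $\langle u,u\rangle\ge 0$. A Lipschitzian curve $g(t)$ in $G$ is horizontal if $g'(t)=dl_{g(t)}(u(t))$ with $u(t)\in\mathfrak{p}$ for almost all $t$; it is timelike if $\langle u(t),u(t)\rangle>0$ and future directed if $\langle u(t),e_0\rangle>0$ for almost all $t$. Let $U=\{u\in\mathfrak{p}\mid \langle u,u\rangle\ge 1,\ \langle u,e_0\rangle>0\}$. A timelike extremal is a future directed timelike horizontal curve $g(t)$, $t\in\mathbb{R}$, parametrized by arclength ($\langle u(t),u(t)\rangle=1$ a.e.), with measurable $u(t)\in U$, for which there is an absolutely continuous nowhere vanishing function $\psi(t)\in\mathfrak{g}^*$ such that for almost all $t$: $g'(t)=dl_{g(t)}(u(t))$; $\frac{d}{dt}\psi(t)(w)=\psi(t)([u(t),w])$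 for all $w\in\mathfrak{g}$; and $\psi(t)(u(t))=\min_{u\in U}\psi(t)(u)=M_0$ with a constant $M_0\ge 0$. The extremal is normal if $M_0>0$; then, multiplying $\psi$ by a positive constant, one assumes $M_0=1$. The components are $\psi_j(t)=\psi(t)(e_j)$; equivalently, identifying $\mathfrak{g}^*$ with $\mathfrak{g}$ via $\langle\cdot,\cdot\rangle$, $\psi(t)=\psi_0(t)e_0-\sum_{i=1}^n\psi_i(t)e_i$. *)

theory Defs
  imports "HOL-Analysis.Analysis" "HOL-Algebra.Group" "HOL-Library.Function_Algebras"
begin

(* Tangent vectors are operators on smooth functions, added and scaled pointwise. *)
instantiation "fun" :: (type, real_vector) real_vector
begin

definition scaleR_fun :: "real \<Rightarrow> ('a \<Rightarrow> 'b) \<Rightarrow> 'a \<Rightarrow> 'b" where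
  "scaleR_fun c f = (\<lambda>x. c *\<^sub>R f x)"

instance
  by standard
    (simp_all add: scaleR_fun_def fun_eq_iff scaleR_add_right scaleR_add_left)

end


section \<open>Smooth manifolds\<close>

(* C^k on open sets of Euclidean spaces. *)
primrec Ck_on :: "nat \<Rightarrow> 'e::euclidean_space set \<Rightarrow> ('e \<Rightarrow> 'f::euclidean_space) \<Rightarrow> bool" where
  "Ck_on 0 S f \<longleftrightarrow> continuous_on S f"
| "Ck_on (Suc k) S f \<longleftrightarrow>
     (\<forall>x\<in>S. f differentiable (at x)) \<and>
     (\<forall>v. Ck_on k S (\<lambda>x. frechet_derivative f (at x) v))"

definition smooth_on :: "'e::euclidean_space set \<Rightarrow> ('e \<Rightarrow> 'f::euclidean_space) \<Rightarrow> bool" where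
  "smooth_on S f \<longleftrightarrow> (\<forall>k. Ck_on k S f)"

type_synonym ('a, 'e) chart = "'a set \<times> ('a \<Rightarrow> 'e)"

definition chart_of :: "'a topology \<Rightarrow> ('a, 'e::euclidean_space) chart \<Rightarrow> bool" where
  "chart_of T c \<longleftrightarrow> (case c of (U, \<phi>) \<Rightarrow>
     openin T U \<and> open (\<phi> ` U) \<and>
     homeomorphic_map (subtopology T U) (top_of_set (\<phi> ` U)) \<phi>)"

definition smooth_manifold :: "'a topology \<Rightarrow> ('a, 'e::euclidean_space) chart set \<Rightarrow> bool" where
  "smooth_manifold T A \<longleftrightarrow>
     Hausdorff_space T \<and> second_countable T \<and>
     (\<forall>c\<in>A. chart_of T c) \<and> (\<Union>c\<in>A. fst c) = topspace T \<and>
     (\<forall>(U, \<phi>)\<in>A. \<forall>(V, \<theta>)\<in>A. smooth_on (\<phi> ` (U \<inter> V)) (\<theta> \<circ> inv_into U \<phi>))"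

definition prod_atlas ::
    "('a, 'e) chart set \<Rightarrow> ('b, 'f) chart set \<Rightarrow> ('a \<times> 'b, 'e \<times> 'f) chart set" where
  "prod_atlas A B = {(U \<times> V, map_prod \<phi> \<theta>) | U \<phi> V \<theta>. (U, \<phi>) \<in> A \<and> (V, \<theta>) \<in> B}"

definition euclidean_atlas :: "('e::euclidean_space, 'e) chart set" where
  "euclidean_atlas = {(UNIV, id)}"

definition smooth_map ::
    "'a topology \<Rightarrow> ('a, 'e::euclidean_space) chart set \<Rightarrow>
     'b topology \<Rightarrow> ('b, 'f::euclidean_space) chart set \<Rightarrow> ('a \<Rightarrow> 'b) \<Rightarrow> bool" where
  "smooth_map T A T' A' F \<longleftrightarrow>
     continuous_map T T' F \<and>
     (\<forall>(U, \<phi>)\<in>A. \<forall>(V, \<theta>)\<in>A'. smooth_on (\<phi> ` (U \<inter> F -` V)) (\<theta> \<circ> F \<circ> inv_into U \<phi>))"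


section \<open>Lie groups and their Lie algebras\<close>

record ('a, 'e) smooth_group = "'a monoid" +
  gtop :: "'a topology"
  atlas :: "('a, 'e) chart set"

definition lie_group :: "('a, 'e::euclidean_space) smooth_group \<Rightarrow> bool" where
  "lie_group G \<longleftrightarrow>
     group G \<and> topspace (gtop G) = carrier G \<and> smooth_manifold (gtop G) (atlas G) \<and>
     smooth_map (prod_topology (gtop G) (gtop G)) (prod_atlas (atlas G) (atlas G))
       (gtop G) (atlas G) (\<lambda>(x, y). x \<otimes>\<^bsub>G\<^esub> y) \<and>
     smooth_map (gtop G) (atlas G) (gtop G) (atlas G) (m_inv G)"

definition smooth_functions :: "('a, 'e::euclidean_space) smooth_group \<Rightarrow> ('a \<Rightarrow> real) set" where
  "smooth_functions G =
     {f. smooth_map (gtop G) (atlas G) euclidean euclidean_atlas f}"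

type_synonym 'a tangent = "('a \<Rightarrow> real) \<Rightarrow> real"

(* The velocity of a smooth curve c at time 0 is the operator taking a smooth function f to
   the derivative of f o c at 0. It is set to 0 off the smooth functions, so that two tangent
   vectors are equal as soon as they agree on smooth functions. *)
definition tangent_space :: "('a, 'e::euclidean_space) smooth_group \<Rightarrow> 'a \<Rightarrow> 'a tangent set" where
  "tangent_space G p =
     {(\<lambda>f. if f \<in> smooth_functions G then deriv (\<lambda>s. f (c s)) 0 else 0) | c.
        smooth_map euclidean euclidean_atlas (gtop G) (atlas G) c \<and> c (0::real) = p}"

definition lie_algebra :: "('a, 'e::euclidean_space) smooth_group \<Rightarrow> 'a tangent set" where
  "lie_algebra G = tangent_space G \<one>\<^bsub>G\<^esub>"

definition left_shift :: "('a, 'e) smooth_group \<Rightarrow> 'a \<Rightarrow> 'a \<Rightarrow> 'a" where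
  "left_shift G g = (\<lambda>h. g \<otimes>\<^bsub>G\<^esub> h)"

definition differential :: "('a \<Rightarrow> 'a) \<Rightarrow> 'a tangent \<Rightarrow> 'a tangent" where
  "differential F X = (\<lambda>f. X (f \<circ> F))"

(* The left-invariant vector field extending X, as an operator on functions. *)
definition left_field :: "('a, 'e) smooth_group \<Rightarrow> 'a tangent \<Rightarrow> ('a \<Rightarrow> real) \<Rightarrow> 'a \<Rightarrow> real" where
  "left_field G X f = (\<lambda>p. differential (left_shift G p) X f)"

(* The value at the unit of the commutator of the left-invariant fields. *)
definition lie_bracket :: "('a, 'e) smooth_group \<Rightarrow> 'a tangent \<Rightarrow> 'a tangent \<Rightarrow> 'a tangent" where
  "lie_bracket G X Y = (\<lambda>f. X (left_field G Y f) - Y (left_field G X f))"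

definition lie_subalgebra :: "('a, 'e::euclidean_space) smooth_group \<Rightarrow> 'a tangent set \<Rightarrow> bool" where
  "lie_subalgebra G S \<longleftrightarrow>
     S \<subseteq> lie_algebra G \<and> subspace S \<and> (\<forall>x\<in>S. \<forall>y\<in>S. lie_bracket G x y \<in> S)"

definition bracket_generating :: "('a, 'e::euclidean_space) smooth_group \<Rightarrow> 'a tangent set \<Rightarrow> bool" where
  "bracket_generating G P \<longleftrightarrow> \<Inter>{S. lie_subalgebra G S \<and> P \<subseteq> S} = lie_algebra G"


section \<open>Left-invariant sub-Lorentzian structures\<close>

definition basis_of :: "(nat \<Rightarrow> 'v::real_vector) \<Rightarrow> nat \<Rightarrow> 'v set \<Rightarrow> bool" where
  "basis_of b k V \<longleftrightarrow>
     inj_on b {0..k} \<and> independent (b ` {0..k}) \<and> span (b ` {0..k}) = V"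

definition linear_functional_on :: "'v::real_vector set \<Rightarrow> ('v \<Rightarrow> real) \<Rightarrow> bool" where
  "linear_functional_on V \<alpha> \<longleftrightarrow>
     (\<forall>x\<in>V. \<forall>y\<in>V. \<alpha> (x + y) = \<alpha> x + \<alpha> y) \<and>
     (\<forall>c. \<forall>x\<in>V. \<alpha> (c *\<^sub>R x) = c * \<alpha> x)"

definition symmetric_bilinear_on :: "'v::real_vector set \<Rightarrow> ('v \<Rightarrow> 'v \<Rightarrow> real) \<Rightarrow> bool" where
  "symmetric_bilinear_on V B \<longleftrightarrow>
     (\<forall>x\<in>V. linear_functional_on V (B x)) \<and> (\<forall>x\<in>V. \<forall>y\<in>V. B x y = B y x)"

(* Non-degeneracy and the signature (+,-,...,-) of B are expressed by the orthonormal basis. *)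
definition sub_lorentzian_structure ::
    "('a, 'e::euclidean_space) smooth_group \<Rightarrow> 'a tangent set \<Rightarrow> ('a tangent \<Rightarrow> 'a tangent \<Rightarrow> real) \<Rightarrow>
     (nat \<Rightarrow> 'a tangent) \<Rightarrow> nat \<Rightarrow> nat \<Rightarrow> bool" where
  "sub_lorentzian_structure G P B b r n \<longleftrightarrow>
     r \<le> n \<and> symmetric_bilinear_on (lie_algebra G) B \<and>
     basis_of b n (lie_algebra G) \<and>
     (\<forall>i\<le>n. \<forall>j\<le>n. B (b i) (b j) = (if i \<noteq> j then 0 else if i = 0 then 1 else -1)) \<and>
     basis_of b r P \<and> bracket_generating G P"

definition pseudo_norm :: "('v \<Rightarrow> 'v \<Rightarrow> real) \<Rightarrow> 'v \<Rightarrow> real" where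
  "pseudo_norm B u = sqrt (B u u)"


section \<open>Curves\<close>

(* Lipschitzian curves are locally Lipschitz in charts, which amounts to being Lipschitz on
   compact intervals for any Riemannian metric. *)
definition lipschitz_curve :: "('a, 'e::euclidean_space) smooth_group \<Rightarrow> (real \<Rightarrow> 'a) \<Rightarrow> bool" where
  "lipschitz_curve G g \<longleftrightarrow>
     range g \<subseteq> carrier G \<and>
     (\<forall>t. \<forall>(U, \<phi>)\<in>atlas G. g t \<in> U \<longrightarrow>
        (\<exists>\<delta>>0. \<exists>L. g ` {t-\<delta><..<t+\<delta>} \<subseteq> U \<and> L-lipschitz_on {t-\<delta><..<t+\<delta>} (\<phi> \<circ> g)))"

(* For continuous g and X tangent at g t, this is differentiability of g at t in charts
   with g'(t) = X. *)
definition has_velocity ::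
    "('a, 'e::euclidean_space) smooth_group \<Rightarrow> (real \<Rightarrow> 'a) \<Rightarrow> 'a tangent \<Rightarrow> real \<Rightarrow> bool" where
  "has_velocity G g X t \<longleftrightarrow>
     (\<forall>f\<in>smooth_functions G. ((\<lambda>s. f (g s)) has_real_derivative X f) (at t))"

definition absolutely_continuous_on_interval :: "real \<Rightarrow> real \<Rightarrow> (real \<Rightarrow> real) \<Rightarrow> bool" where
  "absolutely_continuous_on_interval a b F \<longleftrightarrow>
     (\<forall>\<epsilon>>0. \<exists>\<delta>>0. \<forall>D. finite D \<longrightarrow> D \<subseteq> {(x, y). a \<le> x \<and> x \<le> y \<and> y \<le> b} \<longrightarrow>
        disjoint_family_on (\<lambda>(x, y). {x<..<y}) D \<longrightarrow>
        (\<Sum>(x, y)\<in>D. y - x) < \<delta> \<longrightarrow> (\<Sum>(x, y)\<in>D. \<bar>F y - F x\<bar>) < \<epsilon>)"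

definition horizontal_curve ::
    "('a, 'e::euclidean_space) smooth_group \<Rightarrow> 'a tangent set \<Rightarrow> (real \<Rightarrow> 'a) \<Rightarrow> (real \<Rightarrow> 'a tangent) \<Rightarrow> bool" where
  "horizontal_curve G P g u \<longleftrightarrow>
     lipschitz_curve G g \<and>
     (AE t in lebesgue. u t \<in> P \<and> has_velocity G g (differential (left_shift G (g t)) (u t)) t)"

definition timelike :: "('v \<Rightarrow> 'v \<Rightarrow> real) \<Rightarrow> (real \<Rightarrow> 'v) \<Rightarrow> bool" where
  "timelike B u \<longleftrightarrow> (AE t in lebesgue. B (u t) (u t) > 0)"

definition future_directed :: "('v \<Rightarrow> 'v \<Rightarrow> real) \<Rightarrow> 'v \<Rightarrow> (real \<Rightarrow> 'v) \<Rightarrow> bool" where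
  "future_directed B b0 u \<longleftrightarrow> (AE t in lebesgue. B (u t) b0 > 0)"

definition arclength_parametrized :: "('v \<Rightarrow> 'v \<Rightarrow> real) \<Rightarrow> (real \<Rightarrow> 'v) \<Rightarrow> bool" where
  "arclength_parametrized B u \<longleftrightarrow> (AE t in lebesgue. B (u t) (u t) = 1)"

definition control_set :: "'v set \<Rightarrow> ('v \<Rightarrow> 'v \<Rightarrow> real) \<Rightarrow> 'v \<Rightarrow> 'v set" where
  "control_set P B b0 = {u\<in>P. B u u \<ge> 1 \<and> B u b0 > 0}"


section \<open>Timelike extremals\<close>

(* The curve g with control u satisfies the extremality conditions with covector function psi
   and constant M. As B is non-degenerate on the finite-dimensional Lie algebra,
   measurability of u is measurability of all t |-> B (u t) w; similarly,
   absolute continuity of psi is that of all t |-> psi t w. *)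
definition timelike_extremal_with ::
    "('a, 'e::euclidean_space) smooth_group \<Rightarrow> 'a tangent set \<Rightarrow> ('a tangent \<Rightarrow> 'a tangent \<Rightarrow> real) \<Rightarrow>
     'a tangent \<Rightarrow> (real \<Rightarrow> 'a) \<Rightarrow> (real \<Rightarrow> 'a tangent) \<Rightarrow> (real \<Rightarrow> 'a tangent \<Rightarrow> real) \<Rightarrow> real \<Rightarrow> bool" where
  "timelike_extremal_with G P B b0 g u \<psi> M \<longleftrightarrow>
     horizontal_curve G P g u \<and> timelike B u \<and> future_directed B b0 u \<and>
     arclength_parametrized B u \<and>
     (\<forall>w\<in>lie_algebra G. (\<lambda>t. B (u t) w) \<in> borel_measurable lebesgue) \<and>
     (\<forall>t. linear_functional_on (lie_algebra G) (\<psi> t)) \<and>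
     (\<forall>t. \<exists>w\<in>lie_algebra G. \<psi> t w \<noteq> 0) \<and>
     (\<forall>w\<in>lie_algebra G. \<forall>a b. absolutely_continuous_on_interval a b (\<lambda>t. \<psi> t w)) \<and>
     (AE t in lebesgue. \<forall>w\<in>lie_algebra G.
        ((\<lambda>s. \<psi> s w) has_real_derivative \<psi> t (lie_bracket G (u t) w)) (at t)) \<and>
     (AE t in lebesgue. u t \<in> control_set P B b0 \<and> \<psi> t (u t) = M \<and>
        (\<forall>v\<in>control_set P B b0. M \<le> \<psi> t v)) \<and>
     M \<ge> 0"

definition normal_timelike_extremal ::
    "('a, 'e::euclidean_space) smooth_group \<Rightarrow> 'a tangent set \<Rightarrow> ('a tangent \<Rightarrow> 'a tangent \<Rightarrow> real) \<Rightarrow>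
     'a tangent \<Rightarrow> (real \<Rightarrow> 'a) \<Rightarrow> bool" where
  "normal_timelike_extremal G P B b0 g \<longleftrightarrow>
     (\<exists>u \<psi> M. M > 0 \<and> timelike_extremal_with G P B b0 g u \<psi> M)"

end

theory Submission
  imports Defs
begin

text \<open>The proof has an algebraic half and a regularity half.

  For the algebraic half, fix a time at which the maximum condition holds. A linear functional
  on \<open>P\<close> that attains its minimum \<open>1\<close> over the solid hyperboloid
  \<open>{v. B v v \<ge> 1, B v (e 0) > 0}\<close> at a point \<open>u\<close> of the boundary must equal
  \<open>B u\<close>, by Lagrange's rule (\<open>minimum_on_hyperboloid\<close>). Hence the control is read off from the
  covector, \<open>u = \<psi>\<^sub>0 e\<^sub>0 - \<Sum> \<psi>\<^sub>i e\<^sub>i\<close>, and inserting this in the adjoint equation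
  gives the stated system, because the bracket is linear in its first argument.

  All of this holds for almost every time only. The regularity half upgrades it to every time.
  The right-hand sides are polynomials in the components of \<open>\<psi>\<close>, or such polynomials times smooth
  functions along \<open>g\<close>, hence continuous in time; and an absolutely continuous function whose
  derivative agrees almost everywhere with a continuous function is differentiable everywhere with
  that derivative (\<open>AC_derivative_everywhere\<close>). This is applied to the components of \<open>\<psi>\<close> and to
  \<open>f \<circ> g\<close> for smooth \<open>f\<close>, which is locally Lipschitz. Equalities between continuous functions,
  such as \<open>\<psi>\<^sub>0\<^sup>2 - \<Sum> \<psi>\<^sub>i\<^sup>2 = 1\<close>, extend from almost all times to all times by themselves.

  Tangent vectors are operators on functions that vanish off the smooth ones, so even the
  linearity of the bracket rests on analysis: the left-invariant derivative of a smooth function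
  must again be smooth (\<open>left_field_smooth\<close>). This is the reason for the calculus of
  \<open>C\<^sup>k\<close> maps and of charts below.\<close>

section \<open>Calculus of \<open>C\<^sup>k\<close> maps\<close>

lemma Ck_on_cong:
  assumes "open S" "\<And>x. x \<in> S \<Longrightarrow> f x = g x" "Ck_on k S f"
  shows "Ck_on k S g"
  using assms(2,3)
proof (induction k arbitrary: f g)
  case 0
  then show ?case by (simp cong: continuous_on_cong)
next
  case (Suc k)
  have diff: "f differentiable (at x)" if "x \<in> S" for x
    using Suc.prems(2) that by simp
  have D: "(g has_derivative frechet_derivative f (at x)) (at x)" if "x \<in> S" for x
    by (rule has_derivative_transform_within_open[OF
          diff[OF that, unfolded frechet_derivative_works] assms(1) that Suc.prems(1)])
  have eq: "frechet_derivative f (at x) = frechet_derivative g (at x)" if "x \<in> S" for x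
    by (rule frechet_derivative_at[OF D[OF that]])
  have "Ck_on k S (\<lambda>x. frechet_derivative g (at x) v)" for v
    by (rule Suc.IH[of "\<lambda>x. frechet_derivative f (at x) v"])
      (use eq Suc.prems(2) in auto)
  moreover have "g differentiable (at x)" if "x \<in> S" for x
    by (rule differentiableI[OF D[OF that]])
  ultimately show ?case by simp
qed

text \<open>The definition of \<open>Ck_on\<close> speaks of \<open>frechet_derivative\<close>, which is awkward to compute with.
  This rule accepts any family of derivatives known by \<open>has_derivative\<close>; the closure
  properties below are all obtained from it.\<close>
lemma Ck_on_SucI:
  assumes "open S" "\<And>x. x \<in> S \<Longrightarrow> (f has_derivative D x) (at x)"
    "\<And>v. Ck_on k S (\<lambda>x. D x v)"
  shows "Ck_on (Suc k) S f"
proof -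
  have "D x = frechet_derivative f (at x)" if "x \<in> S" for x
    by (rule frechet_derivative_at[OF assms(2)[OF that]])
  then have "Ck_on k S (\<lambda>x. frechet_derivative f (at x) v)" for v
    by (intro Ck_on_cong[OF assms(1) _ assms(3)[of v]]) simp
  moreover have "f differentiable (at x)" if "x \<in> S" for x
    by (rule differentiableI[OF assms(2)[OF that]])
  ultimately show ?thesis by simp
qed

lemma Ck_on_SucD:
  assumes "Ck_on (Suc k) S f"
  shows "x \<in> S \<Longrightarrow> (f has_derivative frechet_derivative f (at x)) (at x)"
    and "Ck_on k S (\<lambda>x. frechet_derivative f (at x) v)"
  using assms by (simp_all add: frechet_derivative_works[symmetric])

lemma Ck_on_subset: "Ck_on k S f \<Longrightarrow> T \<subseteq> S \<Longrightarrow> Ck_on k T f"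
proof (induction k arbitrary: f)
  case 0 then show ?case using continuous_on_subset by auto
next
  case (Suc k) then show ?case by (simp add: subset_iff)
qed

lemma Ck_on_lower: "Ck_on (Suc k) S f \<Longrightarrow> Ck_on k S f"
proof (induction k arbitrary: f)
  case 0
  then show ?case
    by (auto intro!: continuous_at_imp_continuous_on differentiable_imp_continuous_within)
next
  case (Suc k)
  have "Ck_on k S (\<lambda>x. frechet_derivative f (at x) v)" for v
    using Suc.prems by (intro Suc.IH) simp
  then show ?case using Suc.prems by simp
qed

lemma Ck_on_local:
  assumes "\<And>x. x \<in> S \<Longrightarrow> \<exists>T. open T \<and> x \<in> T \<and> Ck_on k T f"
  shows "Ck_on k S f"
  using assms
proof (induction k arbitrary: f)
  case 0
  have "isCont f x" if x: "x \<in> S" for x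
  proof -
    obtain T where "open T" "x \<in> T" "continuous_on T f"
      using 0[OF x] by auto
    then show ?thesis by (simp add: continuous_on_eq_continuous_at)
  qed
  then show ?case by (simp add: continuous_at_imp_continuous_on)
next
  case (Suc k)
  have "Ck_on k S (\<lambda>x. frechet_derivative f (at x) v)" for v
  proof (rule Suc.IH)
    fix x assume "x \<in> S"
    then obtain T where "open T" "x \<in> T" "Ck_on (Suc k) T f"
      using Suc.prems by blast
    then show "\<exists>T. open T \<and> x \<in> T \<and> Ck_on k T (\<lambda>x. frechet_derivative f (at x) v)"
      by auto
  qed
  moreover have "f differentiable (at x)" if "x \<in> S" for x
    using Suc.prems[OF that] by auto
  ultimately show ?case by simp
qed

lemma Ck_on_const: "open S \<Longrightarrow> Ck_on k S (\<lambda>x. c)"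
proof (induction k arbitrary: c)
  case (Suc k)
  show ?case
    by (rule Ck_on_SucI[where D="\<lambda>x v. 0"]) (auto intro: Suc simp del: Ck_on.simps)
qed auto

lemma Ck_on_bounded_linear:
  assumes L: "bounded_linear L" and "open S" "Ck_on k S f"
  shows "Ck_on k S (\<lambda>x. L (f x))"
  using assms(3)
proof (induction k arbitrary: f)
  case 0
  then show ?case using bounded_linear.continuous_on[OF L] by simp
next
  case (Suc k)
  show ?case
    by (rule Ck_on_SucI[where D="\<lambda>x v. L (frechet_derivative f (at x) v)"])
      (rule assms(2), rule bounded_linear.has_derivative[OF L Ck_on_SucD(1)[OF Suc.prems]],
        assumption, rule Suc.IH[OF Ck_on_SucD(2)[OF Suc.prems]])
qed

lemma Ck_on_id: "open S \<Longrightarrow> Ck_on k S (\<lambda>x. x)"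
proof (cases k)
  case (Suc m)
  assume "open S"
  then show ?thesis unfolding Suc
    by (intro Ck_on_SucI[where D="\<lambda>x v. v"]) (auto intro: Ck_on_const simp del: Ck_on.simps)
qed auto

lemma Ck_on_add:
  assumes "open S" "Ck_on k S f" "Ck_on k S g"
  shows "Ck_on k S (\<lambda>x. f x + g x)"
  using assms(2,3)
proof (induction k arbitrary: f g)
  case 0
  then show ?case by (simp add: continuous_on_add)
next
  case (Suc k)
  show ?case
    by (rule Ck_on_SucI[where D="\<lambda>x v. frechet_derivative f (at x) v + frechet_derivative g (at x) v"])
      (rule assms(1), rule has_derivative_add[OF Ck_on_SucD(1)[OF Suc.prems(1)]
        Ck_on_SucD(1)[OF Suc.prems(2)]], assumption, assumption,
        rule Suc.IH[OF Ck_on_SucD(2)[OF Suc.prems(1)] Ck_on_SucD(2)[OF Suc.prems(2)]])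
qed

lemma Ck_on_sum:
  assumes "open S" "finite I" "\<And>i. i \<in> I \<Longrightarrow> Ck_on k S (f i)"
  shows "Ck_on k S (\<lambda>x. \<Sum>i\<in>I. f i x)"
  using assms(2,3) by induction (auto intro: Ck_on_const Ck_on_add assms(1) simp del: Ck_on.simps)

lemma Ck_on_scaleR:
  assumes "open S" "Ck_on k S f" "Ck_on k S g"
  shows "Ck_on k S (\<lambda>x. f x *\<^sub>R g x)"
  using assms(2,3)
proof (induction k arbitrary: f g)
  case 0
  then show ?case by (simp add: continuous_on_scaleR)
next
  case (Suc k)
  show ?case
    by (rule Ck_on_SucI[where D="\<lambda>x v. f x *\<^sub>R frechet_derivative g (at x) v +
            frechet_derivative f (at x) v *\<^sub>R g x"])
      (rule assms(1), rule has_derivative_scaleR[OF Ck_on_SucD(1)[OF Suc.prems(1)]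
        Ck_on_SucD(1)[OF Suc.prems(2)]], assumption, assumption,
        rule Ck_on_add[OF assms(1)
          Suc.IH[OF Ck_on_lower[OF Suc.prems(1)] Ck_on_SucD(2)[OF Suc.prems(2)]]
          Suc.IH[OF Ck_on_SucD(2)[OF Suc.prems(1)] Ck_on_lower[OF Suc.prems(2)]]])
qed

text \<open>By the chain rule the derivative of \<open>f \<circ> g\<close> in direction \<open>v\<close> is
  \<open>Df (g x) (Dg x v)\<close>. Expanding the inner vector in the standard basis turns this into a sum
  of products of functions of the form \<open>Dg x v \<bullet> b\<close> and \<open>Df (g x) b\<close>. The latter is
  again a composition, which makes the induction on \<open>k\<close> work for all outer functions at once.\<close>
lemma Ck_on_compose:
  fixes f :: "'b::euclidean_space \<Rightarrow> 'c::euclidean_space" and g :: "'a::euclidean_space \<Rightarrow> 'b"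
  assumes "open S" "open T" "g ` S \<subseteq> T" "Ck_on k S g" "Ck_on k T f"
  shows "Ck_on k S (\<lambda>x. f (g x))"
  using assms(4,5)
proof (induction k arbitrary: f)
  case 0
  then show ?case using assms(3) by (auto intro: continuous_on_compose2)
next
  case (Suc k)
  note Dg = Ck_on_SucD[OF Suc.prems(1)]
  note Df = Ck_on_SucD[OF Suc.prems(2)]
  let ?D = "\<lambda>x v. \<Sum>b\<in>Basis. (frechet_derivative g (at x) v \<bullet> b) *\<^sub>R frechet_derivative f (at (g x)) b"
  show ?case
  proof (rule Ck_on_SucI[where D="?D"])
    fix x assume x: "x \<in> S"
    then have gx: "g x \<in> T" using assms(3) by auto
    have expand: "frechet_derivative f (at (g x)) w
        = (\<Sum>b\<in>Basis. (w \<bullet> b) *\<^sub>R frechet_derivative f (at (g x)) b)" for w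
    proof -
      have lin: "linear (frechet_derivative f (at (g x)))"
        using Df(1)[OF gx] by (blast intro: has_derivative_linear)
      have "frechet_derivative f (at (g x)) w
          = frechet_derivative f (at (g x)) (\<Sum>b\<in>Basis. (w \<bullet> b) *\<^sub>R b)"
        by (simp add: euclidean_representation)
      then show ?thesis
        by (simp add: linear_sum[OF lin] linear_scale[OF lin])
    qed
    show "((\<lambda>x. f (g x)) has_derivative ?D x) (at x)"
      by (rule has_derivative_eq_rhs[OF has_derivative_compose[OF Dg(1)[OF x] Df(1)[OF gx]]
            ext[OF expand]])
  next
    fix v
    show "Ck_on k S (\<lambda>x. ?D x v)"
      by (rule Ck_on_sum[OF assms(1) finite_Basis Ck_on_scaleR[OF assms(1)
            Ck_on_bounded_linear[OF bounded_linear_inner_left assms(1) Dg(2)]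
            Suc.IH[OF Ck_on_lower[OF Suc.prems(1)] Df(2)]]])
  qed (rule assms(1))
qed

text \<open>A pair is the sum of two bounded linear images of its components, which spares a
  further induction.\<close>
lemma Ck_on_Pair:
  assumes "open S" "Ck_on k S f" "Ck_on k S g"
  shows "Ck_on k S (\<lambda>x. (f x, g x))"
proof -
  have 1: "bounded_linear (\<lambda>a. (a, 0))" and 2: "bounded_linear (\<lambda>b. (0, b))"
    by (auto intro!: bounded_linear_Pair bounded_linear_ident bounded_linear_zero)
  show ?thesis
    using Ck_on_add[OF assms(1) Ck_on_bounded_linear[OF 1 assms(1,2)]
        Ck_on_bounded_linear[OF 2 assms(1,3)]] by simp
qed

text \<open>On a closed ball the finitely many partial derivatives are bounded by
  compactness; their bounds add up to a bound for the operator norm of the derivative, and the mean value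
  inequality applies because the ball is convex.\<close>
lemma C1_locally_lipschitz:
  fixes f :: "'a::euclidean_space \<Rightarrow> real"
  assumes "open S" "Ck_on (Suc 0) S f" "x \<in> S"
  obtains d L where "d > 0" "ball x d \<subseteq> S" "L-lipschitz_on (ball x d) f"
proof -
  obtain d where d: "d > 0" "cball x d \<subseteq> S"
    using assms open_contains_cball by blast
  have "\<exists>M. \<forall>y\<in>cball x d. \<bar>frechet_derivative f (at y) b\<bar> \<le> M" for b
  proof -
    have "continuous_on (cball x d) (\<lambda>y. frechet_derivative f (at y) b)"
      using assms(2) by (intro continuous_on_subset[OF _ d(2)]) simp
    then have "bounded ((\<lambda>y. frechet_derivative f (at y) b) ` cball x d)"
      by (simp add: compact_continuous_image compact_imp_bounded)
    then show ?thesis by (auto simp: bounded_iff)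
  qed
  then obtain M where M: "\<And>b y. y \<in> cball x d \<Longrightarrow> \<bar>frechet_derivative f (at y) b\<bar> \<le> M b"
    by metis
  define L where "L = (\<Sum>b\<in>Basis. M b)"
  have L0: "0 \<le> L"
    unfolding L_def using M[of x] d(1) by (intro sum_nonneg) (meson abs_ge_zero centre_in_cball less_imp_le order_trans)
  have der: "(f has_derivative frechet_derivative f (at y)) (at y)" if "y \<in> cball x d" for y
    using assms(2) d(2) that Ck_on_SucD(1) by blast
  have on: "onorm (frechet_derivative f (at y)) \<le> L" if y: "y \<in> ball x d" for y
  proof (rule onorm_bound[OF L0])
    fix w
    have lin: "linear (frechet_derivative f (at y))"
      using der[of y] y by (auto intro: has_derivative_linear)
    have "frechet_derivative f (at y) w = frechet_derivative f (at y) (\<Sum>b\<in>Basis. (w \<bullet> b) *\<^sub>R b)"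
      by (simp add: euclidean_representation)
    also have "\<dots> = (\<Sum>b\<in>Basis. (w \<bullet> b) * frechet_derivative f (at y) b)"
      by (simp add: linear_sum[OF lin] linear_scale[OF lin])
    also have "norm \<dots> \<le> (\<Sum>b\<in>Basis. norm w * M b)"
      using y M[of y] by (intro sum_norm_le) (auto simp: abs_mult Basis_le_norm intro!: mult_mono)
    finally show "norm (frechet_derivative f (at y) w) \<le> L * norm w"
      by (simp add: L_def sum_distrib_left mult.commute)
  qed
  have "L-lipschitz_on (ball x d) f"
  proof (rule lipschitz_onI[OF _ L0])
    fix y z assume yz: "y \<in> ball x d" "z \<in> ball x d"
    show "dist (f y) (f z) \<le> L * dist y z"
      unfolding dist_norm
      by (rule differentiable_bound[OF convex_ball _ on yz])
        (auto intro: has_derivative_at_withinI[OF der])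
  qed
  moreover have "ball x d \<subseteq> S" using d(2) by auto
  ultimately show ?thesis using that d(1) by blast
qed

section \<open>Absolutely continuous functions on the line\<close>

lemma AC_subset:
  assumes "absolutely_continuous_on_interval a b F" "a \<le> c" "d \<le> b"
  shows "absolutely_continuous_on_interval c d F"
  unfolding absolutely_continuous_on_interval_def
proof (intro allI impI)
  fix \<epsilon> :: real assume "\<epsilon> > 0"
  then obtain \<delta> where \<delta>: "\<delta> > 0" and *: "\<And>D. finite D \<Longrightarrow> D \<subseteq> {(x, y). a \<le> x \<and> x \<le> y \<and> y \<le> b} \<Longrightarrow>
        disjoint_family_on (\<lambda>(x, y). {x<..<y}) D \<Longrightarrow>
        (\<Sum>(x, y)\<in>D. y - x) < \<delta> \<Longrightarrow> (\<Sum>(x, y)\<in>D. \<bar>F y - F x\<bar>) < \<epsilon>"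
    using assms(1) unfolding absolutely_continuous_on_interval_def by meson
  have "{(x, y). c \<le> x \<and> x \<le> y \<and> y \<le> d} \<subseteq> {(x, y). a \<le> x \<and> x \<le> y \<and> y \<le> b}"
    using assms(2,3) by auto
  then show "\<exists>\<delta>>0. \<forall>D. finite D \<longrightarrow> D \<subseteq> {(x, y). c \<le> x \<and> x \<le> y \<and> y \<le> d} \<longrightarrow>
        disjoint_family_on (\<lambda>(x, y). {x<..<y}) D \<longrightarrow>
        (\<Sum>(x, y)\<in>D. y - x) < \<delta> \<longrightarrow> (\<Sum>(x, y)\<in>D. \<bar>F y - F x\<bar>) < \<epsilon>"
    by (intro exI[of _ \<delta>] conjI \<delta> allI impI *) (assumption, erule (1) subset_trans)
qed

lemma AC_divide:
  assumes AC: "absolutely_continuous_on_interval a b F" and M: "M > 0"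
  shows "absolutely_continuous_on_interval a b (\<lambda>t. F t / M)"
  unfolding absolutely_continuous_on_interval_def
proof (intro allI impI)
  fix \<epsilon> :: real assume "\<epsilon> > 0"
  then have "\<epsilon> * M > 0" using M by simp
  then obtain \<delta> where \<delta>: "\<delta> > 0" and *: "\<And>D. finite D \<Longrightarrow> D \<subseteq> {(x, y). a \<le> x \<and> x \<le> y \<and> y \<le> b} \<Longrightarrow>
        disjoint_family_on (\<lambda>(x, y). {x<..<y}) D \<Longrightarrow>
        (\<Sum>(x, y)\<in>D. y - x) < \<delta> \<Longrightarrow> (\<Sum>(x, y)\<in>D. \<bar>F y - F x\<bar>) < \<epsilon> * M"
    using AC unfolding absolutely_continuous_on_interval_def by meson
  show "\<exists>\<delta>>0. \<forall>D. finite D \<longrightarrow> D \<subseteq> {(x, y). a \<le> x \<and> x \<le> y \<and> y \<le> b} \<longrightarrow>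
        disjoint_family_on (\<lambda>(x, y). {x<..<y}) D \<longrightarrow>
        (\<Sum>(x, y)\<in>D. y - x) < \<delta> \<longrightarrow> (\<Sum>(x, y)\<in>D. \<bar>F y / M - F x / M\<bar>) < \<epsilon>"
  proof (intro exI[of _ \<delta>] conjI \<delta> allI impI)
    fix D assume D: "finite D" "D \<subseteq> {(x, y). a \<le> x \<and> x \<le> y \<and> y \<le> b}"
      "disjoint_family_on (\<lambda>(x, y). {x<..<y}) D" "(\<Sum>(x, y)\<in>D. y - x) < \<delta>"
    have "\<bar>F y / M - F x / M\<bar> = \<bar>F y - F x\<bar> / M" for x y
      using M by (simp add: diff_divide_distrib[symmetric])
    then have "(\<Sum>(x, y)\<in>D. \<bar>F y / M - F x / M\<bar>) = (\<Sum>(x, y)\<in>D. \<bar>F y - F x\<bar>) / M"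
      by (simp add: sum_divide_distrib split_def)
    also have "\<dots> < \<epsilon>" using *[OF D] M by (simp add: divide_less_eq)
    finally show "(\<Sum>(x, y)\<in>D. \<bar>F y / M - F x / M\<bar>) < \<epsilon>" .
  qed
qed

lemma lipschitz_imp_AC:
  assumes L: "L-lipschitz_on {a..b} F"
  shows "absolutely_continuous_on_interval a b F"
  unfolding absolutely_continuous_on_interval_def
proof (intro allI impI)
  fix \<epsilon> :: real assume \<epsilon>: "\<epsilon> > 0"
  have L0: "L \<ge> 0" using L by (rule lipschitz_on_nonneg)
  show "\<exists>\<delta>>0. \<forall>D. finite D \<longrightarrow> D \<subseteq> {(x, y). a \<le> x \<and> x \<le> y \<and> y \<le> b} \<longrightarrow>
        disjoint_family_on (\<lambda>(x, y). {x<..<y}) D \<longrightarrow>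
        (\<Sum>(x, y)\<in>D. y - x) < \<delta> \<longrightarrow> (\<Sum>(x, y)\<in>D. \<bar>F y - F x\<bar>) < \<epsilon>"
  proof (intro exI[of _ "\<epsilon> / (L + 1)"] conjI allI impI)
    show "\<epsilon> / (L + 1) > 0" using \<epsilon> L0 by simp
    fix D assume D: "D \<subseteq> {(x, y). a \<le> x \<and> x \<le> y \<and> y \<le> b}"
      and less: "(\<Sum>(x, y)\<in>D. y - x) < \<epsilon> / (L + 1)"
    have nn: "0 \<le> (\<Sum>(x, y)\<in>D. y - x)" using D by (intro sum_nonneg) auto
    have "(\<Sum>(x, y)\<in>D. \<bar>F y - F x\<bar>) \<le> (\<Sum>d\<in>D. L * (case d of (x, y) \<Rightarrow> y - x))"
    proof (rule sum_mono)
      fix d assume "d \<in> D"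
      then obtain x y where d: "d = (x, y)" "a \<le> x" "x \<le> y" "y \<le> b" using D by auto
      then show "(case d of (x, y) \<Rightarrow> \<bar>F y - F x\<bar>) \<le> L * (case d of (x, y) \<Rightarrow> y - x)"
        using lipschitz_onD[OF L, of y x] by (simp add: dist_real_def)
    qed
    also have "\<dots> = L * (\<Sum>(x, y)\<in>D. y - x)" by (simp add: sum_distrib_left)
    also have "\<dots> \<le> (L + 1) * (\<Sum>(x, y)\<in>D. y - x)" using nn by (simp add: algebra_simps)
    also have "\<dots> < \<epsilon>" using less L0 by (simp add: field_simps)
    finally show "(\<Sum>(x, y)\<in>D. \<bar>F y - F x\<bar>) < \<epsilon>" .
  qed
qed

lemma AC_imp_continuous:
  assumes AC: "\<And>a b. absolutely_continuous_on_interval a b F"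
  shows "continuous_on UNIV F"
proof -
  have "isCont F t" for t
    unfolding continuous_at_eps_delta
  proof (intro allI impI)
    fix \<epsilon> :: real assume "\<epsilon> > 0"
    then obtain \<delta> where \<delta>: "\<delta> > 0" and *: "\<And>D. finite D \<Longrightarrow> D \<subseteq> {(x, y). t-1 \<le> x \<and> x \<le> y \<and> y \<le> t+1} \<Longrightarrow>
        disjoint_family_on (\<lambda>(x, y). {x<..<y}) D \<Longrightarrow>
        (\<Sum>(x, y)\<in>D. y - x) < \<delta> \<Longrightarrow> (\<Sum>(x, y)\<in>D. \<bar>F y - F x\<bar>) < \<epsilon>"
      using AC[of "t-1" "t+1"] unfolding absolutely_continuous_on_interval_def by meson
    \<comment> \<open>the bound 1 keeps the point inside the interval on which absolute continuity was used\<close>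
    show "\<exists>d>0. \<forall>x'. dist x' t < d \<longrightarrow> dist (F x') (F t) < \<epsilon>"
    proof (intro exI[of _ "min \<delta> 1"] conjI allI impI)
      show "min \<delta> 1 > 0" using \<delta> by simp
      fix s assume "dist s t < min \<delta> 1"
      then have "\<bar>s - t\<bar> < \<delta>" "\<bar>s - t\<bar> < 1" by (auto simp: dist_real_def)
      then show "dist (F s) (F t) < \<epsilon>"
        using *[of "{(min s t, max s t)}"]
        by (cases "s \<le> t") (auto simp: disjoint_family_on_def dist_real_def min_def max_def)
    qed
  qed
  then show ?thesis by (simp add: continuous_at_imp_continuous_on)
qed

lemma tagged_division_intervals:
  fixes a b :: real
  assumes p: "p tagged_division_of {a..b}" and xK: "(x, K) \<in> p"
  shows "a \<le> Inf K" "Inf K \<le> x" "x \<le> Sup K" "Sup K \<le> b" "K = {Inf K..Sup K}"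
proof -
  obtain c d where K: "K = cbox c d" using tagged_division_ofD(4)[OF p xK] by blast
  moreover have "x \<in> K" "K \<subseteq> {a..b}" using tagged_division_ofD(2,3)[OF p xK] by auto
  ultimately show "a \<le> Inf K" "Inf K \<le> x" "x \<le> Sup K" "Sup K \<le> b" "K = {Inf K..Sup K}" by auto
qed

text \<open>The fundamental theorem of calculus for absolutely continuous functions, with the
  Henstock-Kurzweil integral. Let \<open>N\<close> be the null set on which the derivative fails to be \<open>h\<close>;
  changing \<open>h\<close> to \<open>0\<close> on \<open>N\<close> does not affect the integral. The gauge is chosen in
  two ways. At a tag outside \<open>N\<close> it is so fine that the increment of \<open>F\<close> is
  approximated by the derivative. At a tag in \<open>N\<close> it confines the interval to an open set
  \<open>Z \<supseteq> N\<close> of measure less than \<open>\<delta>\<close>; these intervals have total length less than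
  \<open>\<delta>\<close>, so absolute continuity makes the total increment of \<open>F\<close> over them small.\<close>
lemma has_integral_derivative_AC:
  assumes ab: "a \<le> b" and AC: "absolutely_continuous_on_interval a b F"
    and der: "AE t in lebesgue. (F has_real_derivative h t) (at t)"
  shows "(h has_integral (F b - F a)) {a..b}"
proof (cases "a = b")
  case True
  then show ?thesis by (simp add: has_integral_refl)
next
  case False
  with ab have ab: "a \<le> b" "a < b" by auto
  obtain N where N: "\<And>t. t \<notin> N \<Longrightarrow> (F has_real_derivative h t) (at t)"
    and null: "N \<in> null_sets lebesgue"
    using AE_E3[OF der] by auto
  define h0 where "h0 t = (if t \<in> N then 0 else h t)" for t
  have "(h0 has_integral (F b - F a)) {a..b}"
    unfolding has_integral_factor_content_real
  proof (intro allI impI)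
    fix e :: real assume e: "e > 0"
    then have "e * (b - a) / 2 > 0" using ab by simp
    then obtain \<delta> where \<delta>: "\<delta> > 0" and small: "\<And>D. finite D \<Longrightarrow> D \<subseteq> {(x, y). a \<le> x \<and> x \<le> y \<and> y \<le> b} \<Longrightarrow>
        disjoint_family_on (\<lambda>(x, y). {x<..<y}) D \<Longrightarrow>
        (\<Sum>(x, y)\<in>D. y - x) < \<delta> \<Longrightarrow> (\<Sum>(x, y)\<in>D. \<bar>F y - F x\<bar>) < e * (b - a) / 2"
      using AC unfolding absolutely_continuous_on_interval_def by meson
    obtain Z where Z: "open Z" "N \<subseteq> Z" "emeasure lebesgue (Z - N) < ennreal \<delta>"
      using sets_lebesgue_outer_open[OF null_setsD2[OF null] \<delta>] by metis
    have Zm: "emeasure lebesgue Z < ennreal \<delta>"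
      using Z(3) emeasure_Diff_null_set[OF null, of Z] Z(1) by simp
    have "\<exists>\<eta>>0. \<forall>y. \<bar>y - t\<bar> < \<eta> \<longrightarrow> \<bar>F y - F t - (y - t) * h t\<bar> \<le> e / 2 * \<bar>y - t\<bar>"
      if t: "t \<notin> N" for t
    proof -
      have "(F has_derivative (\<lambda>x. x * h t)) (at t)"
        using N[OF t] by (simp add: has_field_derivative_def mult_commute_abs)
      then show ?thesis
        using e unfolding has_derivative_at_alt real_norm_def by (meson half_gt_zero)
    qed
    then obtain \<eta> where \<eta>: "\<And>t. t \<notin> N \<Longrightarrow> \<eta> t > 0"
      "\<And>t y. t \<notin> N \<Longrightarrow> \<bar>y - t\<bar> < \<eta> t \<Longrightarrow> \<bar>F y - F t - (y - t) * h t\<bar> \<le> e / 2 * \<bar>y - t\<bar>"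
      by metis
    define \<gamma> where "\<gamma> t = (if t \<in> N then Z else ball t (\<eta> t))" for t
    have "gauge \<gamma>"
      using Z(1,2) \<eta>(1) by (auto simp: gauge_def \<gamma>_def)
    moreover have "norm ((\<Sum>(x, K)\<in>p. measure lborel K *\<^sub>R h0 x) - (F b - F a)) \<le> e * measure lborel {a..b}"
      if p: "p tagged_division_of {a..b}" and fine: "\<gamma> fine p" for p
    proof -
      note I = tagged_division_intervals[OF p]
      have fin: "finite p" using p by blast
      let ?g = "\<lambda>(x, K). measure lborel K *\<^sub>R h0 x - (F (Sup K) - F (Inf K))"
      let ?len = "\<lambda>(x, K). Sup K - Inf K"
      define q where "q = {z \<in> p. fst z \<in> N}"
      have q: "q \<subseteq> p" "finite q" using fin by (auto simp: q_def)
      have cont: "measure lborel K = Sup K - Inf K" if "(x, K) \<in> p" for x K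
        using I[OF that] by (metis content_real order_trans)
      have "(\<Sum>(x, K)\<in>p. measure lborel K *\<^sub>R h0 x) - (F b - F a) = sum ?g p"
        by (simp add: additive_tagged_division_1[OF ab(1) p, symmetric] sum_subtractf split_def)
      also have "\<dots> = sum ?g q + sum ?g (p - q)"
        using sum.subset_diff[OF q(1) fin, of ?g] by simp
      finally have split: "(\<Sum>(x, K)\<in>p. measure lborel K *\<^sub>R h0 x) - (F b - F a) = \<dots>" .
      have rest: "norm (sum ?g (p - q)) \<le> e * (b - a) / 2"
      proof -
        have "norm (sum ?g (p - q)) \<le> (\<Sum>z\<in>p - q. e / 2 * ?len z)"
        proof (rule sum_norm_le)
          fix z assume z: "z \<in> p - q"
          obtain x K where xK: "z = (x, K)" by (cases z)
          with z have xp: "(x, K) \<in> p" and xN: "x \<notin> N" by (auto simp: q_def)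
          note J = I[OF xp]
          \<comment> \<open>the tag lies in its interval, so the derivative estimate applies on both sides of it\<close>
          have "K \<subseteq> ball x (\<eta> x)" using fineD[OF fine xp] xN by (simp add: \<gamma>_def)
          moreover have "Inf K \<in> K" "Sup K \<in> K" using J by (metis atLeastAtMost_iff order_refl order_trans)+
          ultimately have d: "\<bar>Inf K - x\<bar> < \<eta> x" "\<bar>Sup K - x\<bar> < \<eta> x"
            by (auto simp: dist_real_def abs_minus_commute subset_iff)
          have "(Sup K - Inf K) * h x - (F (Sup K) - F (Inf K))
              = (F (Inf K) - F x - (Inf K - x) * h x) - (F (Sup K) - F x - (Sup K - x) * h x)"
            by (simp add: algebra_simps)
          also have "\<bar>\<dots>\<bar> \<le> e / 2 * \<bar>Inf K - x\<bar> + e / 2 * \<bar>Sup K - x\<bar>"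
            by (rule order_trans[OF abs_triangle_ineq4 add_mono[OF \<eta>(2)[OF xN d(1)] \<eta>(2)[OF xN d(2)]]])
          also have "\<dots> = e / 2 * (Sup K - Inf K)"
            using J(2,3) by (simp add: field_simps)
          finally have "\<bar>(Sup K - Inf K) * h x - (F (Sup K) - F (Inf K))\<bar> \<le> e / 2 * (Sup K - Inf K)" .
          then show "norm (?g z) \<le> e / 2 * ?len z"
            using xN cont[OF xp] by (simp add: xK h0_def)
        qed
        also have "\<dots> = e / 2 * sum ?len (p - q)" by (simp add: sum_distrib_left)
        also have "\<dots> \<le> e / 2 * sum ?len p"
          using e I by (intro mult_left_mono sum_mono2 fin) fastforce+
        also have "sum ?len p = b - a"
          using additive_tagged_division_1[OF ab(1) p, of "\<lambda>x. x"] .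
        finally show ?thesis by simp
      qed
      have inN: "norm (sum ?g q) \<le> e * (b - a) / 2"
      proof -
        define E :: "real \<times> real set \<Rightarrow> real \<times> real" where "E z = (Inf (snd z), Sup (snd z))" for z
        have disj: "{Inf K<..<Sup K} \<inter> {Inf K'<..<Sup K'} = {}"
          if "(x, K) \<in> p" "(x', K') \<in> p" "(x, K) \<noteq> (x', K')" for x K x' K'
        proof -
          have "interior K \<inter> interior K' = {}"
            using tagged_division_ofD(5)[OF p that] .
          moreover have "interior K = {Inf K<..<Sup K}" "interior K' = {Inf K'<..<Sup K'}"
            using I(5)[OF that(1)] I(5)[OF that(2)] interior_atLeastAtMost_real by metis+
          ultimately show ?thesis by simp
        qed
        \<comment> \<open>absolute continuity speaks of sets of intervals, so two tags must not share an interval; for a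
            degenerate interval the tag is its only point\<close>
        have inj: "inj_on E q"
        proof (rule inj_onI)
          fix z z' assume zz: "z \<in> q" "z' \<in> q" "E z = E z'"
          obtain x K x' K' where xK: "z = (x, K)" "z' = (x', K')" by (cases z, cases z')
          then have xp: "(x, K) \<in> p" "(x', K') \<in> p" using zz q by auto
          have eq: "Inf K = Inf K'" "Sup K = Sup K'" using zz(3) by (auto simp: E_def xK)
          then have KK: "K = K'" using I(5)[OF xp(1)] I(5)[OF xp(2)] by simp
          show "z = z'"
          proof (rule ccontr)
            assume "z \<noteq> z'"
            then have "{Inf K<..<Sup K} = {}" using disj[OF xp] eq by (simp add: xK)
            then have "Sup K \<le> Inf K" by (simp add: greaterThanLessThan_empty_iff)
            then show False
              using I(2,3)[OF xp(1)] I(2,3)[OF xp(2)] eq \<open>z \<noteq> z'\<close> KK by (simp add: xK)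
          qed
        qed
        have dfam: "disjoint_family_on (\<lambda>(x, y). {x<..<y}) (E ` q)"
          unfolding disjoint_family_on_def
        proof (intro ballI impI)
          fix d d' assume "d \<in> E ` q" "d' \<in> E ` q" "d \<noteq> d'"
          then obtain z z' where zz: "z \<in> q" "z' \<in> q" "z \<noteq> z'" "d = E z" "d' = E z'"
            by blast
          obtain x K x' K' where "z = (x, K)" "z' = (x', K')" by (cases z, cases z')
          with zz q(1) have "(x, K) \<in> p" "(x', K') \<in> p" "(x, K) \<noteq> (x', K')"
            "d = (Inf K, Sup K)" "d' = (Inf K', Sup K')"
            by (auto simp: E_def)
          then show "(case d of (x, y) \<Rightarrow> {x<..<y}) \<inter> (case d' of (x, y) \<Rightarrow> {x<..<y}) = {}"
            using disj by simp
        qed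
        have sub: "E ` q \<subseteq> {(x, y). a \<le> x \<and> x \<le> y \<and> y \<le> b}"
        proof
          fix d assume "d \<in> E ` q"
          then obtain x K where "(x, K) \<in> p" "d = (Inf K, Sup K)"
            using q(1) by (auto simp: E_def)
          then show "d \<in> {(x, y). a \<le> x \<and> x \<le> y \<and> y \<le> b}"
            using I[of x K] by auto
        qed
        have "ennreal (\<Sum>(x, y)\<in>E ` q. y - x) = (\<Sum>(x, y)\<in>E ` q. ennreal (y - x))"
          using sub by (subst sum_ennreal[symmetric]) (auto simp: split_def)
        also have "\<dots> = (\<Sum>d\<in>E ` q. emeasure lebesgue (case d of (x, y) \<Rightarrow> {x<..<y}))"
        proof (rule sum.cong)
          fix d assume "d \<in> E ` q"
          then obtain x y where "d = (x, y)" "x \<le> y" using sub by auto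
          then show "(case d of (x, y) \<Rightarrow> ennreal (y - x)) = emeasure lebesgue (case d of (x, y) \<Rightarrow> {x<..<y})"
            by simp
        qed simp
        also have "\<dots> = emeasure lebesgue (\<Union>d\<in>E ` q. case d of (x, y) \<Rightarrow> {x<..<y})"
          by (rule sum_emeasure[OF _ dfam]) (use q in auto)
        also have "\<dots> \<le> emeasure lebesgue Z"
        proof (rule emeasure_mono)
          show "(\<Union>d\<in>E ` q. case d of (x, y) \<Rightarrow> {x<..<y}) \<subseteq> Z"
          proof (rule UN_least)
            fix d assume "d \<in> E ` q"
            then obtain x K where xK: "(x, K) \<in> p" "x \<in> N" and d: "d = (Inf K, Sup K)"
              by (auto simp: E_def q_def)
            have "K \<subseteq> Z" using fineD[OF fine xK(1)] xK(2) by (simp add: \<gamma>_def)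
            then show "(case d of (x, y) \<Rightarrow> {x<..<y}) \<subseteq> Z"
              using I(5)[OF xK(1)] d by (metis greaterThanLessThan_subseteq_atLeastAtMost_iff order_refl order_trans prod.case)
          qed
        qed (use Z(1) in simp)
        also have "\<dots> < ennreal \<delta>" by (rule Zm)
        finally have "(\<Sum>(x, y)\<in>E ` q. y - x) < \<delta>"
          using \<delta> by (simp add: ennreal_less_iff[OF sum_nonneg] ennreal_less_iff split_def)
            (metis (no_types, lifting) \<delta> ennreal_leI leD leI)
        then have less: "(\<Sum>(x, y)\<in>E ` q. \<bar>F y - F x\<bar>) < e * (b - a) / 2"
          by (intro small sub dfam) (use q in auto)
        have "norm (sum ?g q) \<le> (\<Sum>(x, K)\<in>q. \<bar>F (Sup K) - F (Inf K)\<bar>)"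
          by (intro sum_norm_le) (auto simp: q_def h0_def)
        also have "\<dots> = (\<Sum>(x, y)\<in>E ` q. \<bar>F y - F x\<bar>)"
          by (subst sum.reindex[OF inj]) (simp add: E_def split_def)
        finally show ?thesis using less by simp
      qed
      have "norm ((\<Sum>(x, K)\<in>p. measure lborel K *\<^sub>R h0 x) - (F b - F a)) \<le> e * (b - a) / 2 + e * (b - a) / 2"
        unfolding split by (rule norm_triangle_le[OF add_mono[OF inN rest]])
      then show ?thesis using ab by simp
    qed
    ultimately show "\<exists>d. gauge d \<and> (\<forall>p. p tagged_division_of {a..b} \<and> d fine p \<longrightarrow>
        norm ((\<Sum>(x, K)\<in>p. measure lborel K *\<^sub>R h0 x) - (F b - F a)) \<le> e * measure lborel {a..b})"
      by (intro exI[of _ \<gamma>] conjI allI impI) (assumption, elim conjE)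
  qed
  moreover have "negligible N" using null by (simp add: negligible_iff_null_sets)
  moreover have "h t = h0 t" if "t \<in> {a..b} - N" for t using that by (simp add: h0_def)
  ultimately show ?thesis by (intro has_integral_spike[of N "{a..b}" h h0])
qed

text \<open>Near \<open>t\<close> the function \<open>F\<close> is an indefinite integral of the continuous
  function \<open>h\<close>, and such an integral is differentiable everywhere.\<close>
lemma AC_derivative_everywhere:
  assumes d: "d > 0" and AC: "absolutely_continuous_on_interval (t - d) (t + d) F"
    and der: "AE s in lebesgue. (F has_real_derivative h s) (at s)"
    and h: "continuous_on UNIV h"
  shows "(F has_real_derivative h t) (at t)"
proof -
  let ?a = "t - d" and ?b = "t + d"
  have eq: "F s = F ?a + integral {?a..s} h" if "s \<in> {?a<..<?b}" for s
    using has_integral_derivative_AC[OF _ AC_subset[OF AC order_refl, of s] der] that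
    by (simp add: integral_unique)
  have "((\<lambda>s. integral {?a..s} h) has_real_derivative h t) (at t within {?a..?b})"
    using d by (intro integral_has_real_derivative continuous_on_subset[OF h]) auto
  then have "((\<lambda>s. integral {?a..s} h) has_real_derivative h t) (at t)"
    using d by (simp add: at_within_Icc_at)
  from DERIV_add[OF DERIV_const[of "F ?a"] this]
  have "((\<lambda>s. F ?a + integral {?a..s} h) has_real_derivative h t) (at t)"
    by simp
  then show ?thesis
    by (rule has_field_derivative_transform_within_open[of _ _ _ "{?a<..<?b}"])
      (use d eq in auto)
qed

text \<open>The exceptional set is open and null, hence empty.\<close>
lemma AE_eq_const_imp_eq:
  fixes F :: "real \<Rightarrow> real"
  assumes "continuous_on UNIV F" "AE t in lebesgue. F t = c"
  shows "F t = c"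
proof (rule ccontr)
  assume neq: "F t \<noteq> c"
  have "open {t. F t \<noteq> c}"
    by (rule open_Collect_neq) (use assms(1) in auto)
  moreover have "negligible {t. F t \<noteq> c}"
    using assms(2) by (simp add: completion.AE_iff_null_sets negligible_iff_null_sets)
  ultimately show False using open_not_negligible neq by blast
qed

section \<open>Smooth maps in charts\<close>

lemma smooth_on_cong:
  assumes "open S" "\<And>x. x \<in> S \<Longrightarrow> f x = g x" "smooth_on S f"
  shows "smooth_on S g"
  unfolding smooth_on_def
proof
  fix k
  have "Ck_on k S f" using assms(3) by (simp add: smooth_on_def)
  then show "Ck_on k S g" by (rule Ck_on_cong[OF assms(1), rotated]) (rule assms(2))
qed

lemma smooth_on_subset: "smooth_on S f \<Longrightarrow> T \<subseteq> S \<Longrightarrow> smooth_on T f"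
  unfolding smooth_on_def using Ck_on_subset by blast

lemma smooth_on_compose:
  fixes f :: "'b::euclidean_space \<Rightarrow> 'c::euclidean_space" and g :: "'a::euclidean_space \<Rightarrow> 'b"
  assumes "open S" "open T" "g ` S \<subseteq> T" "smooth_on S g" "smooth_on T f"
  shows "smooth_on S (\<lambda>x. f (g x))"
  using assms(4,5) unfolding smooth_on_def by (blast intro: Ck_on_compose[OF assms(1-3)])

lemma smooth_on_local:
  assumes "\<And>x. x \<in> S \<Longrightarrow> \<exists>T. open T \<and> x \<in> T \<and> smooth_on T f"
  shows "smooth_on S f"
  unfolding smooth_on_def
proof (intro allI Ck_on_local)
  fix k x assume "x \<in> S"
  then show "\<exists>T. open T \<and> x \<in> T \<and> Ck_on k T f"
    using assms unfolding smooth_on_def by meson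
qed

lemma smooth_on_frechet_derivative:
  assumes "smooth_on S f"
  shows "smooth_on S (\<lambda>x. frechet_derivative f (at x) v)"
  unfolding smooth_on_def
proof
  fix k
  have "Ck_on (Suc k) S f" using assms unfolding smooth_on_def by blast
  then show "Ck_on k S (\<lambda>x. frechet_derivative f (at x) v)" by (rule Ck_on_SucD(2))
qed

lemma smooth_on_has_derivative:
  assumes "smooth_on S f" "x \<in> S"
  shows "(f has_derivative frechet_derivative f (at x)) (at x)"
proof -
  have "Ck_on (Suc 0) S f" using assms(1) unfolding smooth_on_def by blast
  then show ?thesis using assms(2) by (rule Ck_on_SucD(1))
qed

lemma smooth_on_continuous: "smooth_on S f \<Longrightarrow> continuous_on S f"
  unfolding smooth_on_def using Ck_on.simps(1) by blast

text \<open>The purely topological content of an atlas, which is all that composition of smooth maps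
  relies on: an intermediate point is only ever seen through a single chart.\<close>
definition atlas_on :: "'a topology \<Rightarrow> ('a, 'e::euclidean_space) chart set \<Rightarrow> bool" where
  "atlas_on T A \<longleftrightarrow> (\<forall>c\<in>A. chart_of T c) \<and> (\<Union>c\<in>A. fst c) = topspace T"

lemma chart_ofD:
  assumes "chart_of T (U, \<phi>)"
  shows "openin T U" "open (\<phi> ` U)" "inj_on \<phi> U" "U \<subseteq> topspace T"
    and "openin T W \<Longrightarrow> W \<subseteq> U \<Longrightarrow> open (\<phi> ` W)"
    and "open S \<Longrightarrow> openin T {p \<in> U. \<phi> p \<in> S}"
proof -
  have hm: "homeomorphic_map (subtopology T U) (top_of_set (\<phi> ` U)) \<phi>"
    using assms by (simp add: chart_of_def)
  show U: "openin T U" and opn: "open (\<phi> ` U)"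
    using assms by (auto simp: chart_of_def)
  then show sub: "U \<subseteq> topspace T" by (simp add: openin_subset)
  show "inj_on \<phi> U"
    using homeomorphic_imp_injective_map[OF hm] sub by (simp add: Int_absorb1)
  show "open (\<phi> ` W)" if "openin T W" "W \<subseteq> U"
    using homeomorphic_imp_open_map[OF hm] that opn
    by (auto simp: open_map_def openin_open_subtopology[OF U] openin_open_eq)
  show "openin T {p \<in> U. \<phi> p \<in> S}" if S: "open S"
  proof -
    have "openin (top_of_set (\<phi> ` U)) (\<phi> ` U \<inter> S)"
      using S by (simp add: openin_open_Int)
    from openin_continuous_map_preimage[OF homeomorphic_imp_continuous_map[OF hm] this]
    have "openin (subtopology T U) {p \<in> U. \<phi> p \<in> \<phi> ` U \<inter> S}"
      using sub by (simp add: Int_absorb1)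
    moreover have "{p \<in> U. \<phi> p \<in> \<phi> ` U \<inter> S} = {p \<in> U. \<phi> p \<in> S}" by auto
    ultimately show ?thesis by (simp add: openin_open_subtopology[OF U])
  qed
qed

lemma atlas_onD:
  assumes "atlas_on T A"
  shows "c \<in> A \<Longrightarrow> chart_of T c"
    and "p \<in> topspace T \<Longrightarrow> \<exists>U \<phi>. (U, \<phi>) \<in> A \<and> p \<in> U"
  using assms unfolding atlas_on_def by (simp, fastforce)

lemma atlas_on_euclidean: "atlas_on euclidean euclidean_atlas"
  by (simp add: atlas_on_def euclidean_atlas_def chart_of_def homeomorphic_map_id
      homeomorphic_map_eq[of _ _ id])

lemma atlas_on_prod:
  assumes A: "atlas_on T A" and B: "atlas_on T' B"
  shows "atlas_on (prod_topology T T') (prod_atlas A B)"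
  unfolding atlas_on_def
proof (intro conjI ballI)
  fix c assume "c \<in> prod_atlas A B"
  then obtain U \<phi> V \<theta> where c: "c = (U \<times> V, map_prod \<phi> \<theta>)" and UV: "(U, \<phi>) \<in> A" "(V, \<theta>) \<in> B"
    unfolding prod_atlas_def by auto
  have cU: "chart_of T (U, \<phi>)" and cV: "chart_of T' (V, \<theta>)"
    using atlas_onD(1) A B UV by auto
  obtain \<phi>' \<theta>' where
    "homeomorphic_maps (subtopology T U) (top_of_set (\<phi> ` U)) \<phi> \<phi>'"
    "homeomorphic_maps (subtopology T' V) (top_of_set (\<theta> ` V)) \<theta> \<theta>'"
    using cU cV by (auto simp: chart_of_def homeomorphic_map_maps)
  then have "homeomorphic_maps (prod_topology (subtopology T U) (subtopology T' V))
      (prod_topology (top_of_set (\<phi> ` U)) (top_of_set (\<theta> ` V)))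
      (\<lambda>(x, y). (\<phi> x, \<theta> y)) (\<lambda>(x, y). (\<phi>' x, \<theta>' y))"
    by (simp only: homeomorphic_maps_prod simp_thms)
  then have "homeomorphic_map (subtopology (prod_topology T T') (U \<times> V))
      (top_of_set (\<phi> ` U \<times> \<theta> ` V)) (\<lambda>(x, y). (\<phi> x, \<theta> y))"
    unfolding subtopology_Times homeomorphic_map_maps prod_topology_subtopology_eu
    by (rule exI[of _ "\<lambda>(x, y). (\<phi>' x, \<theta>' y)"])
  moreover have "(\<lambda>(x, y). (\<phi> x, \<theta> y)) = map_prod \<phi> \<theta>" by auto
  moreover have "map_prod \<phi> \<theta> ` (U \<times> V) = \<phi> ` U \<times> \<theta> ` V"
    by (rule map_prod_surj_on) auto
  ultimately show "chart_of (prod_topology T T') c"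
    using chart_ofD(1,2)[OF cU] chart_ofD(1,2)[OF cV]
    by (simp add: c chart_of_def openin_prod_Times_iff open_Times)
next
  have "(\<Union>c\<in>prod_atlas A B. fst c) = (\<Union>c\<in>A. fst c) \<times> (\<Union>c\<in>B. fst c)"
  proof (intro equalityI subsetI)
    fix z assume "z \<in> (\<Union>c\<in>prod_atlas A B. fst c)"
    then show "z \<in> (\<Union>c\<in>A. fst c) \<times> (\<Union>c\<in>B. fst c)"
      unfolding prod_atlas_def by force
  next
    fix z assume "z \<in> (\<Union>c\<in>A. fst c) \<times> (\<Union>c\<in>B. fst c)"
    then obtain U \<phi> V \<theta> where "(U, \<phi>) \<in> A" "(V, \<theta>) \<in> B" "z \<in> U \<times> V" by auto
    then show "z \<in> (\<Union>c\<in>prod_atlas A B. fst c)"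
      unfolding prod_atlas_def by (intro UN_I[of "(U \<times> V, map_prod \<phi> \<theta>)"]) auto
  qed
  then show "(\<Union>c\<in>prod_atlas A B. fst c) = topspace (prod_topology T T')"
    using A B by (simp add: atlas_on_def)
qed

lemma smooth_mapD:
  assumes "smooth_map T A T' A' F"
  shows "continuous_map T T' F"
    and "(U, \<phi>) \<in> A \<Longrightarrow> (V, \<theta>) \<in> A' \<Longrightarrow> smooth_on (\<phi> ` (U \<inter> F -` V)) (\<theta> \<circ> F \<circ> inv_into U \<phi>)"
  using assms unfolding smooth_map_def by auto

lemma smooth_mapI:
  assumes "continuous_map T T' F"
    and "\<And>U \<phi> V \<theta>. (U, \<phi>) \<in> A \<Longrightarrow> (V, \<theta>) \<in> A' \<Longrightarrow>
      smooth_on (\<phi> ` (U \<inter> F -` V)) (\<theta> \<circ> F \<circ> inv_into U \<phi>)"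
  shows "smooth_map T A T' A' F"
  using assms unfolding smooth_map_def by auto

lemma openin_chart_preimage:
  assumes "continuous_map T T' F" "openin T U" "openin T' V"
  shows "openin T (U \<inter> F -` V)"
  using openin_continuous_map_preimage_gen[OF assms] by (simp add: vimage_def Int_def)

text \<open>Smoothness is local, so near a given point one may insert a chart \<open>\<theta>\<close> around its
  image under \<open>F\<close> and factor the coordinate expression of \<open>H \<circ> F\<close> through it.\<close>
lemma smooth_map_compose:
  assumes A: "atlas_on T A" and A': "atlas_on T' A'" and A'': "atlas_on T'' A''"
    and F: "smooth_map T A T' A' F" and H: "smooth_map T' A' T'' A'' H"
  shows "smooth_map T A T'' A'' (H \<circ> F)"
proof (rule smooth_mapI)
  show contHF: "continuous_map T T'' (H \<circ> F)"
    using smooth_mapD(1)[OF F] smooth_mapD(1)[OF H] by (rule continuous_map_compose)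
  fix U \<phi> W \<kappa> assume UA: "(U, \<phi>) \<in> A" and WA: "(W, \<kappa>) \<in> A''"
  note cU = chart_ofD[OF atlas_onD(1)[OF A UA]] and cW = chart_ofD[OF atlas_onD(1)[OF A'' WA]]
  show "smooth_on (\<phi> ` (U \<inter> (H \<circ> F) -` W)) (\<kappa> \<circ> (H \<circ> F) \<circ> inv_into U \<phi>)"
  proof (rule smooth_on_local)
    fix x assume "x \<in> \<phi> ` (U \<inter> (H \<circ> F) -` W)"
    then obtain p where p: "p \<in> U" "H (F p) \<in> W" "x = \<phi> p" by auto
    have "F p \<in> topspace T'"
      using smooth_mapD(1)[OF F] p(1) cU(4) by (auto simp: continuous_map_def)
    then obtain V \<theta> where VA: "(V, \<theta>) \<in> A'" and FV: "F p \<in> V"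
      using atlas_onD(2)[OF A'] by blast
    note cV = chart_ofD[OF atlas_onD(1)[OF A' VA]]
    let ?O = "(U \<inter> F -` V) \<inter> (H \<circ> F) -` W"
    have "openin T ?O"
      by (intro openin_chart_preimage[OF contHF _ cW(1)]
          openin_chart_preimage[OF smooth_mapD(1)[OF F] cU(1) cV(1)])
    then have opO: "open (\<phi> ` ?O)" by (rule cU(5)) auto
    have opV: "open (\<theta> ` (V \<inter> H -` W))"
      by (rule cV(5)[OF openin_chart_preimage[OF smooth_mapD(1)[OF H] cV(1) cW(1)]]) auto
    have inv: "inv_into U \<phi> (\<phi> q) = q" if "q \<in> U" for q
      using cU(3) that by (rule inv_into_f_f)
    have inv': "inv_into V \<theta> (\<theta> q) = q" if "q \<in> V" for q
      using cV(3) that by (rule inv_into_f_f)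
    have "smooth_on (\<phi> ` ?O) (\<lambda>x. (\<kappa> \<circ> H \<circ> inv_into V \<theta>) ((\<theta> \<circ> F \<circ> inv_into U \<phi>) x))"
    proof (rule smooth_on_compose[OF opO opV])
      show "(\<theta> \<circ> F \<circ> inv_into U \<phi>) ` \<phi> ` ?O \<subseteq> \<theta> ` (V \<inter> H -` W)"
        using inv by auto
      show "smooth_on (\<phi> ` ?O) (\<theta> \<circ> F \<circ> inv_into U \<phi>)"
        by (rule smooth_on_subset[OF smooth_mapD(2)[OF F UA VA]]) auto
      show "smooth_on (\<theta> ` (V \<inter> H -` W)) (\<kappa> \<circ> H \<circ> inv_into V \<theta>)"
        by (rule smooth_mapD(2)[OF H VA WA])
    qed
    then have "smooth_on (\<phi> ` ?O) (\<kappa> \<circ> (H \<circ> F) \<circ> inv_into U \<phi>)"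
      by (rule smooth_on_cong[OF opO, rotated]) (use inv inv' in auto)
    moreover have "x \<in> \<phi> ` ?O" using p FV by auto
    ultimately show "\<exists>S. open S \<and> x \<in> S \<and> smooth_on S (\<kappa> \<circ> (H \<circ> F) \<circ> inv_into U \<phi>)"
      using opO by blast
  qed
qed

text \<open>The coordinate expression pairs a constant with a change of charts; this is the
  place where compatibility of the charts enters.\<close>
lemma smooth_map_pair_const:
  assumes M: "smooth_manifold T A" and p: "p \<in> topspace T"
  shows "smooth_map T A (prod_topology T T) (prod_atlas A A) (\<lambda>x. (p, x))"
proof (rule smooth_mapI)
  show "continuous_map T (prod_topology T T) (\<lambda>x. (p, x))"
    using p by (intro continuous_map_pairedI) auto
  have A: "atlas_on T A" using M by (simp add: smooth_manifold_def atlas_on_def)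
  fix U \<phi> O' \<omega> assume UA: "(U, \<phi>) \<in> A" and "(O', \<omega>) \<in> prod_atlas A A"
  then obtain V \<theta> W \<kappa> where O': "O' = V \<times> W" "\<omega> = map_prod \<theta> \<kappa>" and VW: "(V, \<theta>) \<in> A" "(W, \<kappa>) \<in> A"
    unfolding prod_atlas_def by auto
  note cU = chart_ofD[OF atlas_onD(1)[OF A UA]] and cW = chart_ofD[OF atlas_onD(1)[OF A VW(2)]]
  have op: "open (\<phi> ` (U \<inter> W))"
    by (rule cU(5)) (use cU(1) cW(1) in auto)
  have "smooth_on (\<phi> ` (U \<inter> W)) (\<kappa> \<circ> inv_into U \<phi>)"
    using M UA VW(2) unfolding smooth_manifold_def by fast
  then have "smooth_on (\<phi> ` (U \<inter> W)) (\<lambda>x. (\<theta> p, (\<kappa> \<circ> inv_into U \<phi>) x))"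
    unfolding smooth_on_def by (intro allI Ck_on_Pair[OF op Ck_on_const[OF op]]) blast
  then have "smooth_on (\<phi> ` (U \<inter> (\<lambda>x. (p, x)) -` (V \<times> W))) (\<lambda>x. (\<theta> p, (\<kappa> \<circ> inv_into U \<phi>) x))"
    by (rule smooth_on_subset) auto
  moreover have "map_prod \<theta> \<kappa> \<circ> (\<lambda>x. (p, x)) \<circ> inv_into U \<phi> = (\<lambda>x. (\<theta> p, (\<kappa> \<circ> inv_into U \<phi>) x))"
    by auto
  ultimately show "smooth_on (\<phi> ` (U \<inter> (\<lambda>x. (p, x)) -` O')) (\<omega> \<circ> (\<lambda>x. (p, x)) \<circ> inv_into U \<phi>)"
    by (simp add: O')
qed

lemma lie_groupD:
  assumes "lie_group G"
  shows "group G" "topspace (gtop G) = carrier G" "smooth_manifold (gtop G) (atlas G)"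
    "atlas_on (gtop G) (atlas G)"
    "smooth_map (prod_topology (gtop G) (gtop G)) (prod_atlas (atlas G) (atlas G))
       (gtop G) (atlas G) (\<lambda>(x, y). x \<otimes>\<^bsub>G\<^esub> y)"
  using assms by (auto simp: lie_group_def smooth_manifold_def atlas_on_def)

text \<open>The left shift by \<open>p\<close> is the multiplication restricted to the slice \<open>{p} \<times> G\<close>.\<close>
lemma left_shift_smooth:
  assumes G: "lie_group G" and p: "p \<in> carrier G"
  shows "smooth_map (gtop G) (atlas G) (gtop G) (atlas G) (left_shift G p)"
proof -
  note L = lie_groupD[OF G]
  have "smooth_map (gtop G) (atlas G) (gtop G) (atlas G) ((\<lambda>(x, y). x \<otimes>\<^bsub>G\<^esub> y) \<circ> (\<lambda>x. (p, x)))"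
    by (rule smooth_map_compose[OF L(4) atlas_on_prod[OF L(4) L(4)] L(4)
          smooth_map_pair_const[OF L(3)] L(5)]) (use p L(2) in simp)
  then show ?thesis by (simp add: left_shift_def comp_def)
qed

lemma smooth_functions_iff:
  "f \<in> smooth_functions G \<longleftrightarrow> continuous_map (gtop G) euclidean f \<and>
     (\<forall>(U, \<phi>)\<in>atlas G. smooth_on (\<phi> ` U) (f \<circ> inv_into U \<phi>))"
  by (simp add: smooth_functions_def smooth_map_def euclidean_atlas_def)

lemma smooth_functions_compose:
  assumes G: "lie_group G" and f: "f \<in> smooth_functions G"
    and A: "atlas_on T A" and F: "smooth_map T A (gtop G) (atlas G) F"
  shows "smooth_map T A euclidean euclidean_atlas (f \<circ> F)"
  by (rule smooth_map_compose[OF A lie_groupD(4)[OF G] atlas_on_euclidean F])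
    (use f in \<open>simp add: smooth_functions_def\<close>)

lemma smooth_functions_left_shift:
  assumes "lie_group G" "f \<in> smooth_functions G" "p \<in> carrier G"
  shows "f \<circ> left_shift G p \<in> smooth_functions G"
  using smooth_functions_compose[OF assms(1,2) lie_groupD(4)[OF assms(1)] left_shift_smooth[OF assms(1,3)]]
  by (simp add: smooth_functions_def)

text \<open>For real functions, continuity is a consequence of smoothness in all charts.\<close>
lemma smooth_functionsI:
  assumes G: "lie_group G"
    and charts: "\<And>U \<phi>. (U, \<phi>) \<in> atlas G \<Longrightarrow> smooth_on (\<phi> ` U) (f \<circ> inv_into U \<phi>)"
  shows "f \<in> smooth_functions G"
proof -
  note A = lie_groupD(4)[OF G]
  have "openin (gtop G) {p \<in> topspace (gtop G). f p \<in> S}" if S: "open S" for S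
  proof (subst openin_subopen, intro ballI)
    fix p assume "p \<in> {p \<in> topspace (gtop G). f p \<in> S}"
    then have p: "p \<in> topspace (gtop G)" "f p \<in> S" by auto
    then obtain U \<phi> where UA: "(U, \<phi>) \<in> atlas G" and pU: "p \<in> U"
      using atlas_onD(2)[OF A] by blast
    note cU = chart_ofD[OF atlas_onD(1)[OF A UA]]
    let ?f = "f \<circ> inv_into U \<phi>"
    have "open (\<phi> ` U \<inter> ?f -` S)"
      using iffD1[OF continuous_on_open_vimage[OF cU(2)] smooth_on_continuous[OF charts[OF UA]]] S
      by (subst Int_commute) blast
    from cU(6)[OF this] have "openin (gtop G) {q \<in> U. \<phi> q \<in> \<phi> ` U \<inter> ?f -` S}" .
    moreover have "{q \<in> U. \<phi> q \<in> \<phi> ` U \<inter> ?f -` S} = {q \<in> U. f q \<in> S}"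
      using inv_into_f_f[OF cU(3)] by (intro Collect_cong conj_cong refl) simp
    ultimately show "\<exists>W. openin (gtop G) W \<and> p \<in> W \<and> W \<subseteq> {p \<in> topspace (gtop G). f p \<in> S}"
      using p(2) pU cU(4) by (intro exI[of _ "{q \<in> U. f q \<in> S}"]) auto
  qed
  then show ?thesis using charts by (auto simp: smooth_functions_iff continuous_map_def)
qed

lemma smooth_functionsD:
  assumes "f \<in> smooth_functions G" "(U, \<phi>) \<in> atlas G"
  shows "smooth_on (\<phi> ` U) (f \<circ> inv_into U \<phi>)"
  using bspec[OF conjunct2[OF assms(1)[unfolded smooth_functions_iff]] assms(2)] by simp

text \<open>Only values on the group matter. Functions are total on the ambient type, and
  \<open>left_field\<close> produces unspecified values off the group, so this must be made explicit.\<close>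
lemma smooth_functions_cong:
  assumes G: "lie_group G" and eq: "\<And>p. p \<in> carrier G \<Longrightarrow> f p = f' p"
    and f: "f \<in> smooth_functions G"
  shows "f' \<in> smooth_functions G"
proof (rule smooth_functionsI[OF G])
  fix U \<phi> assume UA: "(U, \<phi>) \<in> atlas G"
  note cU = chart_ofD[OF atlas_onD(1)[OF lie_groupD(4)[OF G] UA]]
  show "smooth_on (\<phi> ` U) (f' \<circ> inv_into U \<phi>)"
  proof (rule smooth_on_cong[OF cU(2) _ smooth_functionsD[OF f UA]])
    fix x assume "x \<in> \<phi> ` U"
    then have "inv_into U \<phi> x \<in> carrier G"
      using subsetD[OF cU(4) inv_into_into[of x \<phi> U]] lie_groupD(2)[OF G] by simp
    then show "(f \<circ> inv_into U \<phi>) x = (f' \<circ> inv_into U \<phi>) x" by (simp add: eq)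
  qed
qed

lemma smooth_functions_lincomb:
  assumes G: "lie_group G" and I: "finite I" and f: "\<And>i. i \<in> I \<Longrightarrow> f i \<in> smooth_functions G"
  shows "(\<lambda>p. \<Sum>i\<in>I. a i * f i p) \<in> smooth_functions G"
proof (rule smooth_functionsI[OF G])
  fix U \<phi> assume UA: "(U, \<phi>) \<in> atlas G"
  note cU = chart_ofD[OF atlas_onD(1)[OF lie_groupD(4)[OF G] UA]]
  have "smooth_on (\<phi> ` U) (\<lambda>x. \<Sum>i\<in>I. a i *\<^sub>R (f i \<circ> inv_into U \<phi>) x)"
    unfolding smooth_on_def
  proof
    fix k
    show "Ck_on k (\<phi> ` U) (\<lambda>x. \<Sum>i\<in>I. a i *\<^sub>R (f i \<circ> inv_into U \<phi>) x)"
    proof (rule Ck_on_sum[OF cU(2) I], rule Ck_on_scaleR[OF cU(2) Ck_on_const[OF cU(2)]])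
      fix i assume "i \<in> I"
      from smooth_functionsD[OF f[OF this] UA]
      show "Ck_on k (\<phi> ` U) (f i \<circ> inv_into U \<phi>)" by (simp add: smooth_on_def)
    qed
  qed
  then show "smooth_on (\<phi> ` U) ((\<lambda>p. \<Sum>i\<in>I. a i * f i p) \<circ> inv_into U \<phi>)"
    by (simp add: comp_def)
qed

section \<open>Tangent vectors and left-invariant fields\<close>

lemma sum_fun_apply: "(\<Sum>i\<in>I. f i) x = (\<Sum>i\<in>I. f i x)"
  by (induction I rule: infinite_finite_induct) auto

lemma tangent_spaceE:
  assumes "X \<in> tangent_space G p"
  obtains c where "smooth_map euclidean euclidean_atlas (gtop G) (atlas G) c" "c (0::real) = p"
    "X = (\<lambda>f. if f \<in> smooth_functions G then deriv (\<lambda>s. f (c s)) 0 else 0)"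
  using assms unfolding tangent_space_def by auto

lemma smooth_curve_in_carrier:
  assumes G: "lie_group G" and c: "smooth_map euclidean euclidean_atlas (gtop G) (atlas G) c"
  shows "c s \<in> carrier G"
  using smooth_mapD(1)[OF c] lie_groupD(2)[OF G] by (auto simp: continuous_map_def)

lemma smooth_along_curve:
  fixes c :: "real \<Rightarrow> 'a"
  assumes G: "lie_group G" and c: "smooth_map euclidean euclidean_atlas (gtop G) (atlas G) c"
    and f: "f \<in> smooth_functions G"
  shows "((\<lambda>s. f (c s)) has_real_derivative deriv (\<lambda>s. f (c s)) s) (at s)"
proof -
  have "smooth_on UNIV (f \<circ> c)"
    using smooth_mapD(2)[OF smooth_functions_compose[OF G f atlas_on_euclidean c], of UNIV id UNIV id]
    by (simp add: euclidean_atlas_def)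
  then have "(f \<circ> c) differentiable (at s)"
    using smooth_on_has_derivative[of UNIV "f \<circ> c" s] by (auto intro: differentiableI)
  then have "(f \<circ> c) field_differentiable (at s)"
    by (auto simp: field_differentiable_def real_differentiable_def)
  then show ?thesis
    by (simp add: comp_def field_differentiable_derivI)
qed

text \<open>Linearity is confined to smooth functions: a tangent vector is set to \<open>0\<close> on the others,
  and the sum of two of these may well be smooth.\<close>
lemma tangent_lincomb:
  assumes G: "lie_group G" and X: "X \<in> tangent_space G p"
    and I: "finite I" and f: "\<And>i. i \<in> I \<Longrightarrow> f i \<in> smooth_functions G"
  shows "X (\<lambda>q. \<Sum>i\<in>I. a i * f i q) = (\<Sum>i\<in>I. a i * X (f i))"
proof -
  obtain c where c: "smooth_map euclidean euclidean_atlas (gtop G) (atlas G) c"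
    and c0: "c 0 = p"
    and Xdef: "X = (\<lambda>f. if f \<in> smooth_functions G then deriv (\<lambda>s. f (c s)) 0 else 0)"
    using X by (rule tangent_spaceE)
  have Xc: "X f = deriv (\<lambda>s. f (c s)) 0" if "f \<in> smooth_functions G" for f
    using that by (simp add: Xdef)
  have "((\<lambda>s. \<Sum>i\<in>I. a i * f i (c s)) has_real_derivative (\<Sum>i\<in>I. a i * X (f i))) (at 0)"
  proof (rule DERIV_sum)
    fix i assume i: "i \<in> I"
    show "((\<lambda>s. a i * f i (c s)) has_real_derivative a i * X (f i)) (at 0)"
      unfolding Xc[OF f[OF i]] by (rule DERIV_cmult[OF smooth_along_curve[OF G c f[OF i]]])
  qed
  then show ?thesis
    by (simp add: Xc[OF smooth_functions_lincomb[OF G I f]] DERIV_imp_deriv)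
qed

lemma tangent_cong:
  assumes G: "lie_group G" and X: "X \<in> tangent_space G p"
    and eq: "\<And>q. q \<in> carrier G \<Longrightarrow> f q = f' q"
  shows "X f = X f'"
proof -
  obtain c where c: "smooth_map euclidean euclidean_atlas (gtop G) (atlas G) c"
    and c0: "c 0 = p"
    and Xdef: "X = (\<lambda>f. if f \<in> smooth_functions G then deriv (\<lambda>s. f (c s)) 0 else 0)"
    using X by (rule tangent_spaceE)
  have "f \<in> smooth_functions G \<longleftrightarrow> f' \<in> smooth_functions G"
    using smooth_functions_cong[OF G, of f f'] smooth_functions_cong[OF G, of f' f] eq by auto
  moreover have "(\<lambda>s. f (c s)) = (\<lambda>s. f' (c s))"
    using eq smooth_curve_in_carrier[OF G c] by auto
  ultimately show ?thesis
    by (simp add: Xdef)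
qed

text \<open>Let \<open>X\<close> be the velocity of a curve \<open>c\<close> through the unit. In charts \<open>\<phi>\<close> near
  \<open>p\<close> and \<open>\<theta>\<close> near the unit, \<open>f (p c(s))\<close> becomes \<open>K (x, \<theta> (c s))\<close> with
  \<open>x = \<phi> p\<close> and a smooth \<open>K\<close>, since multiplication is smooth. Its derivative at \<open>s = 0\<close> is
  the derivative of \<open>K\<close> at \<open>(x, \<theta> 1)\<close> in the fixed direction \<open>(0, w)\<close>, where \<open>w\<close> is the
  velocity of \<open>\<theta> \<circ> c\<close>; this is a smooth function of \<open>x\<close>.\<close>
lemma left_field_smooth:
  assumes G: "lie_group G" and X: "X \<in> lie_algebra G" and f: "f \<in> smooth_functions G"
  shows "left_field G X f \<in> smooth_functions G"
proof (rule smooth_functionsI[OF G])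
  note L = lie_groupD[OF G]
  obtain c where c: "smooth_map euclidean euclidean_atlas (gtop G) (atlas G) c"
    and c0: "c 0 = \<one>\<^bsub>G\<^esub>"
    and Xdef: "X = (\<lambda>f. if f \<in> smooth_functions G then deriv (\<lambda>s. f (c s)) 0 else 0)"
    using X unfolding lie_algebra_def by (rule tangent_spaceE)
  have Xc: "X f = deriv (\<lambda>s. f (c s)) 0" if "f \<in> smooth_functions G" for f
    using that by (simp add: Xdef)
  have "\<one>\<^bsub>G\<^esub> \<in> topspace (gtop G)"
    using L(1,2) by (simp add: group.is_monoid)
  then obtain W \<theta> where WA: "(W, \<theta>) \<in> atlas G" and eW: "\<one>\<^bsub>G\<^esub> \<in> W"
    using atlas_onD(2)[OF L(4)] by blast
  note cW = chart_ofD[OF atlas_onD(1)[OF L(4) WA]]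
  have opc: "open (c -` W)"
    using openin_chart_preimage[OF smooth_mapD(1)[OF c] _ cW(1), of UNIV] by simp
  have "smooth_on (c -` W) (\<theta> \<circ> c)"
    using smooth_mapD(2)[OF c _ WA, of UNIV id] by (simp add: euclidean_atlas_def)
  from smooth_on_has_derivative[OF this, of 0]
  have dc: "((\<theta> \<circ> c) has_derivative frechet_derivative (\<theta> \<circ> c) (at 0)) (at 0)"
    using eW c0 by simp
  define w where "w = frechet_derivative (\<theta> \<circ> c) (at 0) 1"
  define y0 where "y0 = \<theta> \<one>\<^bsub>G\<^esub>"
  have y0: "y0 \<in> \<theta> ` W" using eW by (simp add: y0_def)
  fix U \<phi> assume UA: "(U, \<phi>) \<in> atlas G"
  note cU = chart_ofD[OF atlas_onD(1)[OF L(4) UA]]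
  define K where "K = (\<lambda>z. f (inv_into U \<phi> (fst z) \<otimes>\<^bsub>G\<^esub> inv_into W \<theta> (snd z)))"
  have opO: "open (\<phi> ` U \<times> \<theta> ` W)" using cU(2) cW(2) by (rule open_Times)
  have K: "smooth_on (\<phi> ` U \<times> \<theta> ` W) K"
  proof (rule smooth_on_cong[OF opO])
    let ?m = "\<lambda>(x, y). x \<otimes>\<^bsub>G\<^esub> y" and ?\<Phi> = "map_prod \<phi> \<theta>"
    have im: "?\<Phi> ` (U \<times> W) = \<phi> ` U \<times> \<theta> ` W" by (rule map_prod_surj_on) auto
    have inj: "inj_on ?\<Phi> (U \<times> W)" using cU(3) cW(3) by (rule map_prod_inj_on)
    have "smooth_map (prod_topology (gtop G) (gtop G)) (prod_atlas (atlas G) (atlas G))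
        euclidean euclidean_atlas (f \<circ> ?m)"
      by (rule smooth_functions_compose[OF G f atlas_on_prod[OF L(4) L(4)] L(5)])
    from smooth_mapD(2)[OF this, of "U \<times> W" ?\<Phi> UNIV id]
    show "smooth_on (\<phi> ` U \<times> \<theta> ` W) ((f \<circ> ?m) \<circ> inv_into (U \<times> W) ?\<Phi>)"
      using UA WA im by (auto simp: prod_atlas_def euclidean_atlas_def)
    fix z assume "z \<in> \<phi> ` U \<times> \<theta> ` W"
    then obtain p q where z: "p \<in> U" "q \<in> W" "z = ?\<Phi> (p, q)" by auto
    have "inv_into (U \<times> W) ?\<Phi> z = (p, q)"
      using inv_into_f_f[OF inj, of "(p, q)"] z by simp
    then show "((f \<circ> ?m) \<circ> inv_into (U \<times> W) ?\<Phi>) z = K z"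
      using z inv_into_f_f[OF cU(3)] inv_into_f_f[OF cW(3)] by (simp add: K_def)
  qed
  have "smooth_on (\<phi> ` U) (\<lambda>x. frechet_derivative K (at (x, y0)) (0, w))"
  proof (rule smooth_on_compose[OF cU(2) opO, of "\<lambda>x. (x, y0)"])
    show "smooth_on (\<phi> ` U) (\<lambda>x. (x, y0))"
      unfolding smooth_on_def
      by (intro allI Ck_on_Pair[OF cU(2) Ck_on_id[OF cU(2)] Ck_on_const[OF cU(2)]])
    show "smooth_on (\<phi> ` U \<times> \<theta> ` W) (\<lambda>z. frechet_derivative K (at z) (0, w))"
      by (rule smooth_on_frechet_derivative[OF K])
  qed (use y0 in auto)
  then show "smooth_on (\<phi> ` U) (left_field G X f \<circ> inv_into U \<phi>)"
  proof (rule smooth_on_cong[OF cU(2), rotated])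
    fix x assume x: "x \<in> \<phi> ` U"
    define p where "p = inv_into U \<phi> x"
    have pU: "p \<in> U" and px: "\<phi> p = x"
      using x by (auto simp: p_def inv_into_into f_inv_into_f)
    have pG: "p \<in> carrier G" using pU cU(4) L(2) by auto
    have xy: "(x, y0) \<in> \<phi> ` U \<times> \<theta> ` W" using x y0 by simp
    have "((\<lambda>s. (x, (\<theta> \<circ> c) s)) has_derivative (\<lambda>s. (0, frechet_derivative (\<theta> \<circ> c) (at 0) s))) (at 0)"
      by (intro has_derivative_Pair has_derivative_const dc)
    moreover have "(K has_derivative frechet_derivative K (at (x, y0))) (at (x, (\<theta> \<circ> c) 0))"
      using smooth_on_has_derivative[OF K xy] by (simp add: c0 y0_def)
    ultimately have "((\<lambda>s. K (x, (\<theta> \<circ> c) s)) has_derivative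
        (\<lambda>s. frechet_derivative K (at (x, y0)) (0, frechet_derivative (\<theta> \<circ> c) (at 0) s))) (at 0)"
      by (rule has_derivative_compose)
    then have *: "((\<lambda>s. f (p \<otimes>\<^bsub>G\<^esub> c s)) has_derivative
        (\<lambda>s. frechet_derivative K (at (x, y0)) (0, frechet_derivative (\<theta> \<circ> c) (at 0) s))) (at 0)"
      by (rule has_derivative_transform_within_open[OF _ opc])
        (use eW c0 inv_into_f_f[OF cW(3)] in \<open>auto simp: K_def p_def\<close>)
    have "((\<lambda>s. f (p \<otimes>\<^bsub>G\<^esub> c s)) has_real_derivative frechet_derivative K (at (x, y0)) (0, w)) (at 0)"
    proof (rule has_derivative_imp_has_field_derivative[OF *])
      fix s
      show "s * frechet_derivative K (at (x, y0)) (0, w)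
          = frechet_derivative K (at (x, y0)) (0, frechet_derivative (\<theta> \<circ> c) (at 0) s)"
        using linear_scale[OF has_derivative_linear[OF *], of s 1] by (simp add: w_def)
    qed
    moreover have "left_field G X f p = deriv (\<lambda>s. f (p \<otimes>\<^bsub>G\<^esub> c s)) 0"
      using Xc[OF smooth_functions_left_shift[OF G f pG]]
      by (simp add: left_field_def differential_def left_shift_def)
    ultimately show "frechet_derivative K (at (x, y0)) (0, w) = (left_field G X f \<circ> inv_into U \<phi>) x"
      by (simp add: DERIV_imp_deriv p_def)
  qed
qed

text \<open>The left shift by \<open>p\<close> is invertible by a smooth map, so it cannot turn a function that
  is not smooth into a smooth one.\<close>
lemma left_field_not_smooth:
  assumes G: "lie_group G" and X: "X \<in> lie_algebra G" and f: "f \<notin> smooth_functions G"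
    and p: "p \<in> carrier G"
  shows "left_field G X f p = 0"
proof -
  interpret group G using lie_groupD(1)[OF G] .
  have "f \<circ> left_shift G p \<notin> smooth_functions G"
  proof
    assume "f \<circ> left_shift G p \<in> smooth_functions G"
    then have "f \<circ> left_shift G p \<circ> left_shift G (inv\<^bsub>G\<^esub> p) \<in> smooth_functions G"
      by (rule smooth_functions_left_shift[OF G]) (use p in simp)
    moreover have "(f \<circ> left_shift G p \<circ> left_shift G (inv\<^bsub>G\<^esub> p)) q = f q" if "q \<in> carrier G" for q
      using p that by (simp add: left_shift_def m_assoc[symmetric])
    ultimately have "f \<in> smooth_functions G" by (rule smooth_functions_cong[OF G, rotated])
    with f show False ..
  qed
  then have "X (f \<circ> left_shift G p) = 0"
    using X by (auto simp: lie_algebra_def tangent_space_def)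
  then show ?thesis by (simp add: left_field_def differential_def)
qed

text \<open>The delicate term is \<open>Y\<close> applied to the linear combination
  of the functions \<open>left_field G (X i) f\<close>. For smooth \<open>f\<close> these are smooth and \<open>Y\<close> is
  linear on them; for other \<open>f\<close> they all vanish on the group.\<close>
lemma lie_bracket_lincomb_left:
  assumes G: "lie_group G" and I: "finite I" and X: "\<And>i. i \<in> I \<Longrightarrow> X i \<in> lie_algebra G"
    and Y: "Y \<in> lie_algebra G"
  shows "lie_bracket G (\<Sum>i\<in>I. a i *\<^sub>R X i) Y = (\<Sum>i\<in>I. a i *\<^sub>R lie_bracket G (X i) Y)"
proof
  fix f
  have Yt: "Y \<in> tangent_space G \<one>\<^bsub>G\<^esub>" using Y by (simp add: lie_algebra_def)
  have lf: "left_field G (\<Sum>i\<in>I. a i *\<^sub>R X i) f = (\<lambda>p. \<Sum>i\<in>I. a i * left_field G (X i) f p)"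
    by (simp add: left_field_def differential_def sum_fun_apply scaleR_fun_def)
  have "Y (\<lambda>p. \<Sum>i\<in>I. a i * left_field G (X i) f p) = (\<Sum>i\<in>I. a i * Y (left_field G (X i) f))"
  proof (cases "f \<in> smooth_functions G")
    case True
    show ?thesis by (rule tangent_lincomb[OF G Yt I left_field_smooth[OF G X True]])
  next
    case False
    have zero: "Y (\<lambda>q. 0) = 0"
      using tangent_lincomb[OF G Yt finite.emptyI] by simp
    have "Y (left_field G (X i) f) = 0" if "i \<in> I" for i
      using tangent_cong[OF G Yt left_field_not_smooth[OF G X[OF that] False]] zero by simp
    moreover have "Y (\<lambda>p. \<Sum>i\<in>I. a i * left_field G (X i) f p) = Y (\<lambda>q. 0)"
      by (rule tangent_cong[OF G Yt]) (simp add: left_field_not_smooth[OF G X False])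
    ultimately show ?thesis using zero by simp
  qed
  then have "lie_bracket G (\<Sum>i\<in>I. a i *\<^sub>R X i) Y f
      = (\<Sum>i\<in>I. a i *\<^sub>R X i) (left_field G Y f) - (\<Sum>i\<in>I. a i * Y (left_field G (X i) f))"
    unfolding lie_bracket_def lf by (rule arg_cong)
  then show "lie_bracket G (\<Sum>i\<in>I. a i *\<^sub>R X i) Y f = (\<Sum>i\<in>I. a i *\<^sub>R lie_bracket G (X i) Y) f"
    by (simp add: lie_bracket_def[of G "X _"] sum_fun_apply scaleR_fun_def right_diff_distrib sum_subtractf)
qed

text \<open>In a chart the function is a \<open>C\<^sup>1\<close> function, which is Lipschitz near
  the point, after a Lipschitz curve. The radius \<open>d\<close> keeps the curve inside the ball where the
  first constant is valid.\<close>
lemma smooth_along_lipschitz_curve: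
  assumes G: "lie_group G" and g: "lipschitz_curve G g" and f: "f \<in> smooth_functions G"
  obtains d L where "d > 0" "L-lipschitz_on {t - d..t + d} (\<lambda>s. f (g s))"
proof -
  note A = lie_groupD(4)[OF G]
  have "g t \<in> topspace (gtop G)"
    using g lie_groupD(2)[OF G] by (auto simp: lipschitz_curve_def)
  then obtain U \<phi> where UA: "(U, \<phi>) \<in> atlas G" and gU: "g t \<in> U"
    using atlas_onD(2)[OF A] by blast
  note cU = chart_ofD[OF atlas_onD(1)[OF A UA]]
  have "\<forall>(U, \<phi>)\<in>atlas G. g t \<in> U \<longrightarrow>
      (\<exists>\<delta>>0. \<exists>L. g ` {t-\<delta><..<t+\<delta>} \<subseteq> U \<and> L-lipschitz_on {t-\<delta><..<t+\<delta>} (\<phi> \<circ> g))"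
    using g unfolding lipschitz_curve_def by (elim conjE allE)
  from bspec[OF this UA] obtain \<delta> L where \<delta>: "\<delta> > 0" and sub: "g ` {t-\<delta><..<t+\<delta>} \<subseteq> U"
    and L: "L-lipschitz_on {t-\<delta><..<t+\<delta>} (\<phi> \<circ> g)"
    using gU by auto
  have "Ck_on (Suc 0) (\<phi> ` U) (f \<circ> inv_into U \<phi>)"
    using smooth_functionsD[OF f UA] unfolding smooth_on_def by blast
  from C1_locally_lipschitz[OF cU(2) this imageI[OF gU]]
  obtain \<rho> M where \<rho>: "\<rho> > 0" and M: "M-lipschitz_on (ball (\<phi> (g t)) \<rho>) (f \<circ> inv_into U \<phi>)"
    by metis
  have L0: "L \<ge> 0" using L by (rule lipschitz_on_nonneg)
  \<comment> \<open>the summand 1 avoids dividing by zero when the curve is constant\<close>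
  define d where "d = min (\<delta> / 2) (\<rho> / (2 * (L + 1)))"
  have d: "d > 0" "d < \<delta>" using \<delta> \<rho> L0 by (auto simp: d_def)
  have Ld: "L * d < \<rho>"
  proof -
    have "L * d \<le> (L + 1) * (\<rho> / (2 * (L + 1)))"
      using L0 d(1) by (intro mult_mono) (auto simp: d_def)
    also have "\<dots> = \<rho> / 2"
    proof -
      have "L + 1 \<noteq> 0" using L0 by simp
      then show ?thesis by (metis nonzero_mult_divide_mult_cancel_left mult.commute times_divide_eq_right)
    qed
    finally show ?thesis using \<rho> by linarith
  qed
  have incl: "{t - d..t + d} \<subseteq> {t-\<delta><..<t+\<delta>}" using d by auto
  have ball: "(\<phi> \<circ> g) ` {t - d..t + d} \<subseteq> ball (\<phi> (g t)) \<rho>"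
  proof
    fix x assume "x \<in> (\<phi> \<circ> g) ` {t - d..t + d}"
    then obtain s where s: "s \<in> {t - d..t + d}" "x = \<phi> (g s)" by auto
    have "dist ((\<phi> \<circ> g) t) ((\<phi> \<circ> g) s) \<le> L * dist t s"
      using s(1) incl d by (intro lipschitz_onD[OF L]) auto
    also have "\<dots> \<le> L * d" using s(1) L0 by (intro mult_left_mono) (auto simp: dist_real_def)
    finally show "x \<in> ball (\<phi> (g t)) \<rho>" using Ld s(2) by simp
  qed
  have "(M * L)-lipschitz_on {t - d..t + d} ((f \<circ> inv_into U \<phi>) \<circ> (\<phi> \<circ> g))"
    by (rule lipschitz_on_compose[OF lipschitz_on_subset[OF L incl] lipschitz_on_subset[OF M ball]])
  moreover have "((f \<circ> inv_into U \<phi>) \<circ> (\<phi> \<circ> g)) s = f (g s)" if "s \<in> {t - d..t + d}" for s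
    using inv_into_f_f[OF cU(3) subsetD[OF sub imageI[OF subsetD[OF incl that]]]] by simp
  ultimately have "(M * L)-lipschitz_on {t - d..t + d} (\<lambda>s. f (g s))"
    by (simp add: lipschitz_on_def)
  with d(1) show ?thesis by (rule that)
qed

lemma smooth_along_lipschitz_curve_continuous:
  assumes G: "lie_group G" and g: "lipschitz_curve G g" and f: "f \<in> smooth_functions G"
  shows "continuous_on UNIV (\<lambda>s. f (g s))"
proof -
  have "isCont (\<lambda>s. f (g s)) t" for t
  proof -
    obtain d L where d: "d > 0" and L: "L-lipschitz_on {t - d..t + d} (\<lambda>s. f (g s))"
      by (rule smooth_along_lipschitz_curve[OF G g f])
    show ?thesis
      by (rule continuous_on_interior[OF lipschitz_on_continuous_on[OF L]]) (use d in simp)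
  qed
  then show ?thesis by (simp add: continuous_at_imp_continuous_on)
qed

section \<open>Lorentzian linear algebra\<close>

lemma linear_functional_on_subset:
  "linear_functional_on V \<alpha> \<Longrightarrow> W \<subseteq> V \<Longrightarrow> linear_functional_on W \<alpha>"
  unfolding linear_functional_on_def by (simp add: subset_iff)

lemma symmetric_bilinear_on_subset:
  assumes "symmetric_bilinear_on V B" "W \<subseteq> V"
  shows "symmetric_bilinear_on W B"
  using assms linear_functional_on_subset[OF _ assms(2)]
  unfolding symmetric_bilinear_on_def by (simp add: subset_iff)

lemma linear_functional_on_sum:
  assumes V: "subspace V" and \<alpha>: "linear_functional_on V \<alpha>" and x: "\<And>i. i \<in> I \<Longrightarrow> x i \<in> V"
  shows "\<alpha> (\<Sum>i\<in>I. a i *\<^sub>R x i) = (\<Sum>i\<in>I. a i * \<alpha> (x i))"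
proof -
  have add: "\<alpha> (y + z) = \<alpha> y + \<alpha> z" and scale: "\<alpha> (c *\<^sub>R y) = c * \<alpha> y"
    if "y \<in> V" "z \<in> V" for y z c
    using \<alpha> that by (auto simp: linear_functional_on_def)
  have zero: "\<alpha> 0 = 0" using scale[of 0 0 0] subspace_0[OF V] by simp
  show ?thesis
    using x
  proof (induction I rule: infinite_finite_induct)
    case (insert i I)
    then have "(\<Sum>i\<in>I. a i *\<^sub>R x i) \<in> V"
      by (intro subspace_sum[OF V] subspace_scale[OF V]) auto
    moreover have "a i *\<^sub>R x i \<in> V" "x i \<in> V" using insert.prems by (auto intro: subspace_scale[OF V])
    ultimately show ?case using insert add scale by simp
  qed (use zero in auto)
qed

text \<open>Lagrange's rule, carried out by hand. If \<open>w\<close> is \<open>B\<close>-orthogonal to \<open>u\<close>, then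
  \<open>u - k a w\<close> has square \<open>1 + k\<^sup>2 a\<^sup>2 B w w\<close>, which differs from \<open>1\<close> to second order in
  \<open>k\<close>, so it can be rescaled into the control set at second order cost. With
  \<open>a = \<alpha> w\<close> the functional decreases by \<open>k a\<^sup>2\<close> to first order, so minimality forces
  \<open>a = 0\<close>. Thus \<open>\<alpha>\<close> and \<open>B u\<close> both vanish on the orthogonal complement of \<open>u\<close>, and
  both are \<open>1\<close> at \<open>u\<close>.\<close>
lemma minimum_on_hyperboloid:
  assumes V: "subspace V" and B: "symmetric_bilinear_on V B" and \<alpha>: "linear_functional_on V \<alpha>"
    and u: "u \<in> V" and b0: "b0 \<in> V" and uu: "B u u = 1" and ub: "B u b0 > 0" and \<alpha>u: "\<alpha> u = 1"
    and minimal: "\<And>v. v \<in> control_set V B b0 \<Longrightarrow> 1 \<le> \<alpha> v"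
    and z: "z \<in> V"
  shows "\<alpha> z = B u z"
proof -
  have lin: "f (x + y) = f x + f y" "f (c *\<^sub>R x) = c * f x"
    if "linear_functional_on V f" "x \<in> V" "y \<in> V" for f x y c
    using that by (auto simp: linear_functional_on_def)
  have BR: "linear_functional_on V (B x)" if "x \<in> V" for x
    using B that by (simp add: symmetric_bilinear_on_def)
  have sym: "B x y = B y x" if "x \<in> V" "y \<in> V" for x y
    using B that by (simp add: symmetric_bilinear_on_def)
  have orth: "\<alpha> w = 0" if w: "w \<in> V" and uw: "B u w = 0" for w
  proof (rule ccontr)
    define a where "a = \<alpha> w"
    assume "\<alpha> w \<noteq> 0"
    then have a: "a^2 > 0" by (simp add: a_def)
    have lims: "((\<lambda>k. 1 + (k * a)^2 * B w w) \<longlongrightarrow> 1 + (0 * a)^2 * B w w) (at_right 0)"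
      "((\<lambda>k. B u b0 - k * a * B w b0) \<longlongrightarrow> B u b0 - 0 * a * B w b0) (at_right 0)"
      "((\<lambda>k. k * (B w w - a^2)) \<longlongrightarrow> 0 * (B w w - a^2)) (at_right 0)"
      by (intro tendsto_intros)+
    \<comment> \<open>for small positive k the competitor stays timelike and future directed, and k is too small for
        the inequality that minimality will give\<close>
    have "\<forall>\<^sub>F k in at_right 0. 0 < 1 + (k * a)^2 * B w w"
      "\<forall>\<^sub>F k in at_right 0. 0 < B u b0 - k * a * B w b0"
      "\<forall>\<^sub>F k in at_right 0. -2 < k * (B w w - a^2)"
      by (rule order_tendstoD(1)[OF lims(1)] order_tendstoD(1)[OF lims(2)]
          order_tendstoD(1)[OF lims(3)], use ub in simp)+
    moreover have "\<forall>\<^sub>F k in at_right (0::real). 0 < k"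
      by (simp add: eventually_at_right_less)
    ultimately have "\<forall>\<^sub>F k in at_right 0. 0 < 1 + (k * a)^2 * B w w \<and>
        0 < B u b0 - k * a * B w b0 \<and> -2 < k * (B w w - a^2) \<and> 0 < k"
      by (intro eventually_conj)
    then obtain k where k: "0 < 1 + (k * a)^2 * B w w" "0 < B u b0 - k * a * B w b0"
      "-2 < k * (B w w - a^2)" "0 < k"
      using eventually_happens[of _ "at_right (0::real)"] by (auto simp: trivial_limit_at_right_real)
    \<comment> \<open>the competitor, and the factor that rescales it to square one\<close>
    define x where "x = u + (- k * a) *\<^sub>R w"
    define l where "l = 1 / sqrt (1 + (k * a)^2 * B w w)"
    have l: "l > 0" "l^2 * (1 + (k * a)^2 * B w w) = 1"
      using k(1) by (auto simp: l_def power_divide)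
    have sw: "(- k * a) *\<^sub>R w \<in> V" using w by (rule subspace_scale[OF V])
    have x: "x \<in> V" unfolding x_def using u sw by (rule subspace_add[OF V])
    have lx: "l *\<^sub>R x \<in> V" using x by (rule subspace_scale[OF V])
    have Bx: "B x y = B u y + (- k * a) * B w y" if y: "y \<in> V" for y
    proof -
      have "B x y = B y u + B y ((- k * a) *\<^sub>R w)"
        using sym[OF x y] lin(1)[OF BR[OF y] u sw] by (simp only: x_def)
      also have "\<dots> = B u y + (- k * a) * B w y"
        using sym[OF y u] sym[OF y w] lin(2)[OF BR[OF y] w w, of "- k * a"] by simp
      finally show ?thesis .
    qed
    have Blx: "B (l *\<^sub>R x) y = l * B x y" if y: "y \<in> V" for y
      using sym[OF lx y] sym[OF x y] lin(2)[OF BR[OF y] x x, of l] by simp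
    have "B x x = 1 + (k * a)^2 * B w w"
      using Bx[OF x] sym[OF u x] sym[OF w x] Bx[OF u] Bx[OF w] uu uw sym[OF w u]
      by (simp add: power2_eq_square algebra_simps)
    then have "B (l *\<^sub>R x) (l *\<^sub>R x) = 1"
      using Blx[OF lx] sym[OF x lx] Blx[OF x] l(2) by (simp add: power2_eq_square algebra_simps)
    moreover have "B (l *\<^sub>R x) b0 > 0"
      using Blx[OF b0] Bx[OF b0] k(2) l(1) by (simp add: mult.assoc)
    ultimately have "1 \<le> \<alpha> (l *\<^sub>R x)"
      using lx by (intro minimal) (simp add: control_set_def)
    also have "\<alpha> (l *\<^sub>R x) = l * (1 - k * a^2)"
      using lin(2)[OF \<alpha> x x, of l] lin(1)[OF \<alpha> u sw] lin(2)[OF \<alpha> w w, of "- k * a"] \<alpha>u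
      by (simp add: x_def a_def power2_eq_square)
    finally have ge: "1 \<le> l * (1 - k * a^2)" .
    then have "1 \<le> (l * (1 - k * a^2))^2"
      by (simp add: one_le_power)
    then have "l^2 * (1 + (k * a)^2 * B w w) \<le> l^2 * (1 - k * a^2)^2"
      using l(2) by (simp add: power_mult_distrib)
    then have "1 + (k * a)^2 * B w w \<le> (1 - k * a^2)^2"
      using l(1) by (simp add: mult_le_cancel_left_pos)
    then have "(k * a^2) * (k * (B w w - a^2)) \<le> (k * a^2) * (-2)"
      by (simp add: power2_eq_square algebra_simps)
    moreover have "0 < k * a^2" using k(4) a by simp
    ultimately have "k * (B w w - a^2) \<le> -2" by (simp only: mult_le_cancel_left_pos)
    with k(3) show False by simp
  qed
  let ?c = "- B u z"
  have cu: "?c *\<^sub>R u \<in> V" using u by (rule subspace_scale[OF V])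
  have "B u (z + ?c *\<^sub>R u) = 0"
    using lin(1)[OF BR[OF u] z cu] lin(2)[OF BR[OF u] u u, of ?c] uu by simp
  then have "\<alpha> (z + ?c *\<^sub>R u) = 0"
    using orth subspace_add[OF V z cu] by blast
  then show ?thesis
    using lin(1)[OF \<alpha> z cu] lin(2)[OF \<alpha> u u, of ?c] \<alpha>u by simp
qed

text \<open>Sums with the signs \<open>(+,-,\<dots>,-)\<close> of the metric are treated as one sum over all
  indices, and split only at the end.\<close>
lemma signed_sum:
  fixes x :: "nat \<Rightarrow> 'v::real_vector"
  shows "(\<Sum>i=0..r. (if i = 0 then 1 else -1) *\<^sub>R x i) = x 0 - (\<Sum>i=1..r. x i)"
  by (simp add: sum.atLeast_Suc_atMost sum_negf)

lemma sub_lorentzianD: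
  assumes S: "sub_lorentzian_structure G P B e r n"
  shows "r \<le> n" "subspace (lie_algebra G)" "subspace P" "P \<subseteq> lie_algebra G"
    "symmetric_bilinear_on (lie_algebra G) B"
    "i \<le> n \<Longrightarrow> e i \<in> lie_algebra G" "i \<le> r \<Longrightarrow> e i \<in> P"
    "i \<le> n \<Longrightarrow> j \<le> n \<Longrightarrow> B (e i) (e j) = (if i \<noteq> j then 0 else if i = 0 then 1 else -1)"
proof -
  have rn: "r \<le> n" and L: "lie_algebra G = span (e ` {0..n})" and P: "P = span (e ` {0..r})"
    using S by (auto simp: sub_lorentzian_structure_def basis_of_def)
  show "r \<le> n" "subspace (lie_algebra G)" "subspace P" "P \<subseteq> lie_algebra G"
    "i \<le> n \<Longrightarrow> e i \<in> lie_algebra G" "i \<le> r \<Longrightarrow> e i \<in> P"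
    using rn unfolding L P by (auto intro: span_base intro!: span_mono)
  show "symmetric_bilinear_on (lie_algebra G) B"
    "i \<le> n \<Longrightarrow> j \<le> n \<Longrightarrow> B (e i) (e j) = (if i \<noteq> j then 0 else if i = 0 then 1 else -1)"
    using S by (auto simp: sub_lorentzian_structure_def)
qed

lemma orthonormal_coefficient:
  assumes S: "sub_lorentzian_structure G P B e r n" and j: "j \<le> r"
  shows "B (\<Sum>i=0..r. a i *\<^sub>R e i) (e j) = a j * (if j = 0 then 1 else -1)"
proof -
  note D = sub_lorentzianD[OF S]
  have e: "e i \<in> lie_algebra G" if "i \<le> r" for i using D(1,6) that by simp
  have s: "(\<Sum>i=0..r. a i *\<^sub>R e i) \<in> lie_algebra G"
    using e by (intro subspace_sum[OF D(2)] subspace_scale[OF D(2)]) auto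
  have "B (\<Sum>i=0..r. a i *\<^sub>R e i) (e j) = B (e j) (\<Sum>i=0..r. a i *\<^sub>R e i)"
    using D(5) s e[OF j] by (simp add: symmetric_bilinear_on_def)
  also have "\<dots> = (\<Sum>i=0..r. a i * B (e j) (e i))"
    using D(5) e j by (intro linear_functional_on_sum[OF D(2)]) (auto simp: symmetric_bilinear_on_def)
  also have "\<dots> = (\<Sum>i=0..r. if i = j then a j * (if j = 0 then 1 else -1) else 0)"
    using D(1,8) j by (intro sum.cong) auto
  also have "\<dots> = a j * (if j = 0 then 1 else -1)" using j by simp
  finally show ?thesis .
qed

lemma orthonormal_expansion:
  assumes S: "sub_lorentzian_structure G P B e r n" and u: "u \<in> P"
  shows "u = (\<Sum>i=0..r. ((if i = 0 then 1 else -1) * B u (e i)) *\<^sub>R e i)"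
proof -
  have inj: "inj_on e {0..r}" and P: "P = span (e ` {0..r})"
    using S by (auto simp: sub_lorentzian_structure_def basis_of_def)
  obtain c where "u = (\<Sum>v\<in>e ` {0..r}. c v *\<^sub>R v)"
    using u unfolding P span_finite[OF finite_imageI[OF finite_atLeastAtMost]] by auto
  then have uc: "u = (\<Sum>i=0..r. c (e i) *\<^sub>R e i)"
    by (simp add: sum.reindex[OF inj])
  have "B u (e i) = c (e i) * (if i = 0 then 1 else -1)" if "i \<le> r" for i
    unfolding uc by (rule orthonormal_coefficient[OF S that])
  then have "(\<Sum>i=0..r. ((if i = 0 then 1 else -1) * B u (e i)) *\<^sub>R e i) = (\<Sum>i=0..r. c (e i) *\<^sub>R e i)"
    by (intro sum.cong) auto
  with uc show ?thesis by simp
qed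

section \<open>The extremal equations\<close>

text \<open>All conditions on the covector are homogeneous, apart from the value of the minimum.\<close>
lemma normalize_extremal:
  assumes E: "timelike_extremal_with G P B b0 g u \<psi> M" and M: "M > 0"
  shows "timelike_extremal_with G P B b0 g u (\<lambda>t w. \<psi> t w / M) 1"
proof -
  have E1: "horizontal_curve G P g u \<and> timelike B u \<and> future_directed B b0 u \<and>
     arclength_parametrized B u \<and>
     (\<forall>w\<in>lie_algebra G. (\<lambda>t. B (u t) w) \<in> borel_measurable lebesgue)"
    and lin: "\<And>t. linear_functional_on (lie_algebra G) (\<psi> t)"
    and nz: "\<forall>t. \<exists>w\<in>lie_algebra G. \<psi> t w \<noteq> 0"
    and AC: "\<forall>w\<in>lie_algebra G. \<forall>a b. absolutely_continuous_on_interval a b (\<lambda>t. \<psi> t w)"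
    and der: "AE t in lebesgue. \<forall>w\<in>lie_algebra G.
        ((\<lambda>s. \<psi> s w) has_real_derivative \<psi> t (lie_bracket G (u t) w)) (at t)"
    and mini: "AE t in lebesgue. u t \<in> control_set P B b0 \<and> \<psi> t (u t) = M \<and>
        (\<forall>v\<in>control_set P B b0. M \<le> \<psi> t v)"
    using E unfolding timelike_extremal_with_def by auto
  have "linear_functional_on (lie_algebra G) (\<lambda>w. \<psi> t w / M)" for t
    using lin[of t] by (simp add: linear_functional_on_def add_divide_distrib)
  moreover have "\<forall>t. \<exists>w\<in>lie_algebra G. \<psi> t w / M \<noteq> 0" using nz M by simp
  moreover have "\<forall>w\<in>lie_algebra G. \<forall>a b. absolutely_continuous_on_interval a b (\<lambda>t. \<psi> t w / M)"
    using AC by (intro ballI allI AC_divide[OF _ M]) blast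
  moreover have "AE t in lebesgue. \<forall>w\<in>lie_algebra G.
        ((\<lambda>s. \<psi> s w / M) has_real_derivative \<psi> t (lie_bracket G (u t) w) / M) (at t)"
    using der
  proof (rule AE_mp, intro AE_I2 impI ballI)
    fix t w assume *: "\<forall>w\<in>lie_algebra G.
        ((\<lambda>s. \<psi> s w) has_real_derivative \<psi> t (lie_bracket G (u t) w)) (at t)" "w \<in> lie_algebra G"
    show "((\<lambda>s. \<psi> s w / M) has_real_derivative \<psi> t (lie_bracket G (u t) w) / M) (at t)"
      by (rule DERIV_cdivide[OF bspec[OF *]])
  qed
  moreover have "AE t in lebesgue. u t \<in> control_set P B b0 \<and> \<psi> t (u t) / M = 1 \<and>
        (\<forall>v\<in>control_set P B b0. 1 \<le> \<psi> t v / M)"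
    using mini by (rule AE_mp, intro AE_I2) (use M in \<open>simp add: le_divide_eq\<close>)
  ultimately show ?thesis
    unfolding timelike_extremal_with_def using E1 by simp
qed

text \<open>The curve \<open>v\<close> is the continuous representative of the control. Being
  built from the covector alone it has a value at every time, so the conditions that hold almost everywhere are first
  moved from \<open>u\<close> to \<open>v\<close> and then extended by continuity or by absolute continuity.\<close>
lemma normalized_extremal_equations:
  fixes G :: "('a, 'e::euclidean_space) smooth_group"
  assumes G: "lie_group G" and S: "sub_lorentzian_structure G P B e r n"
    and C: "\<And>i j. i \<le> n \<Longrightarrow> j \<le> n \<Longrightarrow> lie_bracket G (e i) (e j) = (\<Sum>k=0..n. C i j k *\<^sub>R e k)"
    and E: "timelike_extremal_with G P B (e 0) g u \<psi> 1"
  defines "v \<equiv> (\<lambda>t. \<psi> t (e 0) *\<^sub>R e 0 - (\<Sum>i=1..r. \<psi> t (e i) *\<^sub>R e i))"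
  shows "AE t in lebesgue. u t = v t"
    and "has_velocity G g (differential (left_shift G (g t)) (v t)) t"
    and "pseudo_norm B (v t) = 1"
    and "\<psi> t (e 0) > 0"
    and "j \<le> n \<Longrightarrow> ((\<lambda>s. \<psi> s (e j)) has_real_derivative
          (\<Sum>k=0..n. C 0 j k * \<psi> t (e 0) * \<psi> t (e k)
             - (\<Sum>i=1..r. C i j k * \<psi> t (e i) * \<psi> t (e k)))) (at t)"
proof -
  note D = sub_lorentzianD[OF S]
  define sg :: "nat \<Rightarrow> real" where "sg i = (if i = 0 then 1 else -1)" for i
  \<comment> \<open>with the signs absorbed, one sum over all indices serves all computations\<close>
  have v: "v t = (\<Sum>i=0..r. (sg i * \<psi> t (e i)) *\<^sub>R e i)" for t
    using signed_sum[of "\<lambda>i. \<psi> t (e i) *\<^sub>R e i" r] by (simp add: v_def sg_def)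
  have eL: "e i \<in> lie_algebra G" if "i \<le> r" for i using D(1,6) that by simp
  have hor: "lipschitz_curve G g"
    and vel: "AE t in lebesgue. u t \<in> P \<and> has_velocity G g (differential (left_shift G (g t)) (u t)) t"
    and unit: "AE t in lebesgue. B (u t) (u t) = 1"
    and lin: "\<And>t. linear_functional_on (lie_algebra G) (\<psi> t)"
    and AC: "\<And>w a b. w \<in> lie_algebra G \<Longrightarrow> absolutely_continuous_on_interval a b (\<lambda>t. \<psi> t w)"
    and der: "AE t in lebesgue. \<forall>w\<in>lie_algebra G.
        ((\<lambda>s. \<psi> s w) has_real_derivative \<psi> t (lie_bracket G (u t) w)) (at t)"
    and mini: "AE t in lebesgue. u t \<in> control_set P B (e 0) \<and> \<psi> t (u t) = 1 \<and>
        (\<forall>v\<in>control_set P B (e 0). 1 \<le> \<psi> t v)"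
    using E unfolding timelike_extremal_with_def horizontal_curve_def arclength_parametrized_def by auto
  have cont: "continuous_on UNIV (\<lambda>t. \<psi> t (e i))" if "i \<le> n" for i
    by (rule AC_imp_continuous[OF AC[OF D(6)[OF that]]])
  have contr: "continuous_on UNIV (\<lambda>t. \<psi> t (e i))" if "i \<le> r" for i
    using cont D(1) that by simp
  have psi_u: "AE t in lebesgue. \<forall>z\<in>P. \<psi> t z = B (u t) z"
    using mini unit
  proof eventually_elim
    fix t assume m: "u t \<in> control_set P B (e 0) \<and> \<psi> t (u t) = 1 \<and>
        (\<forall>v\<in>control_set P B (e 0). 1 \<le> \<psi> t v)" and uu: "B (u t) (u t) = 1"
    have BP: "symmetric_bilinear_on P B"
      using symmetric_bilinear_on_subset[OF D(5,4)] .
    have uP: "u t \<in> P" and ub: "B (u t) (e 0) > 0" using m by (auto simp: control_set_def)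
    show "\<forall>z\<in>P. \<psi> t z = B (u t) z"
    proof (rule ballI, rule minimum_on_hyperboloid[where B = B and u = "u t" and ?b0.0 = "e 0", OF D(3) BP _ uP _ uu ub])
      show "linear_functional_on P (\<psi> t)" by (rule linear_functional_on_subset[OF lin D(4)])
      show "e 0 \<in> P" by (rule D(7)) simp
    qed (use m in auto)
  qed
  show uv: "AE t in lebesgue. u t = v t"
    using psi_u vel
  proof eventually_elim
    fix t assume *: "\<forall>z\<in>P. \<psi> t z = B (u t) z"
      and "u t \<in> P \<and> has_velocity G g (differential (left_shift G (g t)) (u t)) t"
    then have uP: "u t \<in> P" by simp
    have "(\<Sum>i=0..r. (sg i * B (u t) (e i)) *\<^sub>R e i) = (\<Sum>i=0..r. (sg i * \<psi> t (e i)) *\<^sub>R e i)"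
      using * D(7) by (intro sum.cong) auto
    then show "u t = v t"
      using orthonormal_expansion[OF S uP] by (simp add: v sg_def)
  qed
  have Bv: "B (v t) (v t) = (\<psi> t (e 0))^2 - (\<Sum>i=1..r. (\<psi> t (e i))^2)" for t
  proof -
    have Bvj: "B (v t) (e j) = \<psi> t (e j)" if "j \<le> r" for j
      unfolding v using orthonormal_coefficient[OF S that, of "\<lambda>i. sg i * \<psi> t (e i)"] by (simp add: sg_def)
    have vL: "v t \<in> lie_algebra G"
      unfolding v using eL by (intro subspace_sum[OF D(2)] subspace_scale[OF D(2)]) auto
    have "B (v t) (v t) = (\<Sum>i=0..r. (sg i * \<psi> t (e i)) * B (v t) (e i))"
      by (subst (2) v, rule linear_functional_on_sum[OF D(2)])
        (use D(5) vL eL in \<open>auto simp: symmetric_bilinear_on_def\<close>)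
    also have "\<dots> = (\<Sum>i=0..r. sg i *\<^sub>R (\<psi> t (e i))^2)"
      using Bvj by (intro sum.cong) (auto simp: power2_eq_square)
    also have "\<dots> = (\<psi> t (e 0))^2 - (\<Sum>i=1..r. (\<psi> t (e i))^2)"
      unfolding sg_def by (rule signed_sum)
    finally show ?thesis .
  qed
  have norm: "B (v t) (v t) = 1" for t
  proof (rule AE_eq_const_imp_eq[where F = "\<lambda>t. B (v t) (v t)"])
    show "continuous_on UNIV (\<lambda>t. B (v t) (v t))"
      unfolding Bv using contr by (intro continuous_intros) auto
    show "AE t in lebesgue. B (v t) (v t) = 1"
      using uv unit by eventually_elim simp
  qed
  then show "pseudo_norm B (v t) = 1" by (simp add: pseudo_norm_def)
  \<comment> \<open>positivity almost everywhere gives nonnegativity by continuity; the value 0 is excluded by the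
      norm, as the remaining terms are not positive\<close>
  have "min (\<psi> t (e 0)) 0 = 0"
  proof (rule AE_eq_const_imp_eq[where F = "\<lambda>t. min (\<psi> t (e 0)) 0"])
    show "continuous_on UNIV (\<lambda>t. min (\<psi> t (e 0)) 0)"
      using contr[of 0] by (intro continuous_intros) simp
    show "AE t in lebesgue. min (\<psi> t (e 0)) 0 = 0"
      using psi_u mini
    proof eventually_elim
      fix t assume *: "\<forall>z\<in>P. \<psi> t z = B (u t) z" and
        "u t \<in> control_set P B (e 0) \<and> \<psi> t (u t) = 1 \<and> (\<forall>v\<in>control_set P B (e 0). 1 \<le> \<psi> t v)"
      then have "B (u t) (e 0) > 0" by (simp add: control_set_def)
      then show "min (\<psi> t (e 0)) 0 = 0" using bspec[OF * D(7)[of 0]] by simp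
    qed
  qed
  moreover have "\<psi> t (e 0) \<noteq> 0"
  proof
    assume "\<psi> t (e 0) = 0"
    moreover have "0 \<le> (\<Sum>i=1..r. (\<psi> t (e i))^2)" by (intro sum_nonneg) simp
    ultimately show False using norm[of t] by (simp add: Bv)
  qed
  ultimately show "\<psi> t (e 0) > 0" by (simp add: min_def split: if_splits)
  show "has_velocity G g (differential (left_shift G (g t)) (v t)) t"
    unfolding has_velocity_def
  proof
    fix f assume f: "f \<in> smooth_functions G"
    define h where "h s = differential (left_shift G (g s)) (v s) f" for s
    have h: "h s = (\<Sum>i=0..r. sg i * \<psi> s (e i) * left_field G (e i) f (g s))" for s
      by (simp add: h_def v differential_def left_field_def sum_fun_apply scaleR_fun_def)
    have conth: "continuous_on UNIV h"
      unfolding h using contr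
      by (intro continuous_intros
          smooth_along_lipschitz_curve_continuous[OF G hor left_field_smooth[OF G eL f]]) auto
    have "AE s in lebesgue. ((\<lambda>s. f (g s)) has_real_derivative h s) (at s)"
      using vel uv
    proof eventually_elim
      fix s assume *: "u s \<in> P \<and> has_velocity G g (differential (left_shift G (g s)) (u s)) s"
        and us: "u s = v s"
      show "((\<lambda>s. f (g s)) has_real_derivative h s) (at s)"
        using bspec[OF conjunct2[OF *, unfolded has_velocity_def] f] by (simp add: h_def us)
    qed
    moreover obtain d L where "d > 0" "L-lipschitz_on {t - d..t + d} (\<lambda>s. f (g s))"
      by (rule smooth_along_lipschitz_curve[OF G hor f])
    ultimately have "((\<lambda>s. f (g s)) has_real_derivative h t) (at t)"
      using AC_derivative_everywhere[OF _ lipschitz_imp_AC _ conth] by blast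
    then show "((\<lambda>s. f (g s)) has_real_derivative differential (left_shift G (g t)) (v t) f) (at t)"
      by (simp add: h_def)
  qed
  assume j: "j \<le> n"
  define R where "R s = (\<Sum>k=0..n. C 0 j k * \<psi> s (e 0) * \<psi> s (e k)
             - (\<Sum>i=1..r. C i j k * \<psi> s (e i) * \<psi> s (e k)))" for s
  have contR: "continuous_on UNIV R"
    unfolding R_def using cont contr by (intro continuous_intros) auto
  have R: "\<psi> s (lie_bracket G (v s) (e j)) = R s" for s
  proof -
    have br: "\<psi> s (lie_bracket G (e i) (e j)) = (\<Sum>k=0..n. C i j k * \<psi> s (e k))" if "i \<le> r" for i
      using C[of i j] that D(1) j linear_functional_on_sum[OF D(2) lin[of s], of "{0..n}" e "C i j"] D(6) by simp
    have brL: "lie_bracket G (e i) (e j) \<in> lie_algebra G" if "i \<le> r" for i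
      using C[of i j] that D(1,6) j
      by (auto intro!: subspace_sum[OF D(2)] subspace_scale[OF D(2)])
    have "lie_bracket G (v s) (e j) = (\<Sum>i=0..r. (sg i * \<psi> s (e i)) *\<^sub>R lie_bracket G (e i) (e j))"
      unfolding v using eL by (intro lie_bracket_lincomb_left[OF G _ _ D(6)[OF j]]) auto
    then have "\<psi> s (lie_bracket G (v s) (e j)) = (\<Sum>i=0..r. (sg i * \<psi> s (e i)) * \<psi> s (lie_bracket G (e i) (e j)))"
      using linear_functional_on_sum[OF D(2) lin[of s], of "{0..r}" "\<lambda>i. lie_bracket G (e i) (e j)"] brL by simp
    also have "\<dots> = (\<Sum>i=0..r. sg i *\<^sub>R (\<Sum>k=0..n. C i j k * \<psi> s (e i) * \<psi> s (e k)))"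
      using br by (intro sum.cong) (auto simp: sum_distrib_left mult_ac)
    also have "\<dots> = (\<Sum>k=0..n. C 0 j k * \<psi> s (e 0) * \<psi> s (e k))
        - (\<Sum>i=1..r. \<Sum>k=0..n. C i j k * \<psi> s (e i) * \<psi> s (e k))"
      unfolding sg_def by (rule signed_sum)
    also have "\<dots> = R s"
      unfolding R_def sum_subtractf by (subst (2) sum.swap) (rule refl)
    finally show ?thesis .
  qed
  have "((\<lambda>s. \<psi> s (e j)) has_real_derivative R t) (at t)"
  proof (rule AC_derivative_everywhere[OF zero_less_one AC[OF D(6)[OF j]] _ contR])
    show "AE s in lebesgue. ((\<lambda>s. \<psi> s (e j)) has_real_derivative R s) (at s)"
      using der uv
    proof eventually_elim
      fix s assume *: "\<forall>w\<in>lie_algebra G.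
        ((\<lambda>s. \<psi> s w) has_real_derivative \<psi> s (lie_bracket G (u s) w)) (at s)" and us: "u s = v s"
      show "((\<lambda>s. \<psi> s (e j)) has_real_derivative R s) (at s)"
        using bspec[OF * D(6)[OF j]] by (simp only: us R)
    qed
  qed
  then show "((\<lambda>s. \<psi> s (e j)) has_real_derivative
          (\<Sum>k=0..n. C 0 j k * \<psi> t (e 0) * \<psi> t (e k)
             - (\<Sum>i=1..r. C i j k * \<psi> t (e i) * \<psi> t (e k)))) (at t)"
    by (simp only: R_def)
qed

theorem theorem2:
  fixes G :: "('a, 'e::euclidean_space) smooth_group"
    and P :: "'a tangent set"
    and B :: "'a tangent \<Rightarrow> 'a tangent \<Rightarrow> real"
    and e :: "nat \<Rightarrow> 'a tangent"
    and C :: "nat \<Rightarrow> nat \<Rightarrow> nat \<Rightarrow> real"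
    and r n :: nat
    and g :: "real \<Rightarrow> 'a"
  assumes "lie_group G" and "connected_space (gtop G)"
    and "sub_lorentzian_structure G P B e r n"
    and "\<forall>i\<le>n. \<forall>j\<le>n. lie_bracket G (e i) (e j) = (\<Sum>k=0..n. C i j k *\<^sub>R e k)"
    and "normal_timelike_extremal G P B (e 0) g"
  shows "(\<exists>u \<psi>. timelike_extremal_with G P B (e 0) g u \<psi> 1) \<and>
    (\<forall>u \<psi>. timelike_extremal_with G P B (e 0) g u \<psi> 1 \<longrightarrow>
      (\<exists>v. (AE t in lebesgue. u t = v t) \<and>
        (\<forall>t. v t = \<psi> t (e 0) *\<^sub>R e 0 - (\<Sum>i=1..r. \<psi> t (e i) *\<^sub>R e i)) \<and>
        (\<forall>t. has_velocity G g (differential (left_shift G (g t)) (v t)) t) \<and>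
        pseudo_norm B (v 0) = 1 \<and>
        (\<forall>t. \<psi> t (e 0) > 0) \<and>
        (\<forall>j\<le>n. \<forall>t. ((\<lambda>s. \<psi> s (e j)) has_real_derivative
          (\<Sum>k=0..n. C 0 j k * \<psi> t (e 0) * \<psi> t (e k)
             - (\<Sum>i=1..r. C i j k * \<psi> t (e i) * \<psi> t (e k)))) (at t))))"
proof (intro conjI allI impI)
  obtain u \<psi> M where "M > 0" "timelike_extremal_with G P B (e 0) g u \<psi> M"
    using assms(5) unfolding normal_timelike_extremal_def by auto
  then show "\<exists>u \<psi>. timelike_extremal_with G P B (e 0) g u \<psi> 1"
    by (blast intro: normalize_extremal)
next
  fix u \<psi> assume E: "timelike_extremal_with G P B (e 0) g u \<psi> 1"
  have C: "lie_bracket G (e i) (e j) = (\<Sum>k=0..n. C i j k *\<^sub>R e k)" if "i \<le> n" "j \<le> n" for i j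
    using assms(4) that by blast
  note eqs = normalized_extremal_equations[where C = C, OF assms(1,3) C E]
  let ?v = "\<lambda>t. \<psi> t (e 0) *\<^sub>R e 0 - (\<Sum>i=1..r. \<psi> t (e i) *\<^sub>R e i)"
  show "\<exists>v. (AE t in lebesgue. u t = v t) \<and>
        (\<forall>t. v t = \<psi> t (e 0) *\<^sub>R e 0 - (\<Sum>i=1..r. \<psi> t (e i) *\<^sub>R e i)) \<and>
        (\<forall>t. has_velocity G g (differential (left_shift G (g t)) (v t)) t) \<and>
        pseudo_norm B (v 0) = 1 \<and>
        (\<forall>t. \<psi> t (e 0) > 0) \<and>
        (\<forall>j\<le>n. \<forall>t. ((\<lambda>s. \<psi> s (e j)) has_real_derivative
          (\<Sum>k=0..n. C 0 j k * \<psi> t (e 0) * \<psi> t (e k)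
             - (\<Sum>i=1..r. C i j k * \<psi> t (e i) * \<psi> t (e k)))) (at t))"
    by (intro exI[of _ ?v] conjI allI impI refl) (rule eqs; assumption)+
qed

end
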